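(* Let $E$ be a field of characteristic different from $2$ and let $v$ be a henselian $\mathbb Z$-valuation on $E$ with $v(2)=0$ whose residue field $\kappa_v$ is separably closed. Let $\pi\in E^\times$ with $v(\pi)=1$ and let $r$ be a positive integer. Consider the diagonal quadratic form over the rational function field $E(X)$ $$\varphi_r=\langle X^r-\pi,\; X^{r+1}+\pi,\; \pi X,\; X(X^r+\pi)\rangle ,$$ i.e. $\varphi_r=(X^r-\pi)Y_1^2+(X^{r+1}+\pi)Y_2^2+\pi XY_3^2+X(X^r+\pi)Y_4^2$. Then $\varphi_r$ is isotropic over the completion $E(X)_w$ for every $w\in\Omega_{r-1}$, but $\varphi_r$ is anisotropic over $E(X)_w$ for some $w\in\Omega_r$.
   Context: A $\mathbb Z$-valuation is a valuation with value group $\mathbb Z$. A valuation $v$ on $E$ is henselian if it extends uniquely to every finite field extension of $E$; $\kappa_v$ denotes its residue field. For $a_1,\dots,a_n\in F^\times$, $\langle a_1,\dots,a_n\rangle$ denotes the quadratic form $a_1Y_1^2+\dots+a_nY_n^2$; a form is isotropic if it has a non-trivial zero, anisotropic otherwise. $E(X)$ is the rational function field in one variable over $E$, and $E(X)_w$ is the completion of $E(X)$ with respect to a $\mathbb Z$-valuation $w$. Let $\Omega_{E(X)}$ be the set of all $\mathbb Z$-valuations on $E(X)$, and for an integer $m\ge 0$ let $\Omega_m=\{w\in\Omega_{E(X)} : w(E^\times)=i\mathbb Z \text{ for some integer } 0\le i\le m\}$ (so $\Omega_0$ is the set of $\mathbb Z$-valuations on $E(X)$ trivial on $E$). *)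

theory Defs
  imports "HOL-Algebra.Algebraic_Closure_Type"
begin

section \<open>Valuations\<close>

text \<open>
  Valuations are written additively. The convention \<open>v 0 = \<infinity>\<close> is encoded by never referring to
  the value of \<open>v\<close> at \<open>0\<close>; accordingly, \<open>v\<close> is a valuation on a subfield \<open>K\<close> if the axioms hold
  on \<open>K - {0}\<close>.
\<close>

definition valuation_on :: "'b::field set \<Rightarrow> ('b \<Rightarrow> 'g::linordered_ab_group_add) \<Rightarrow> bool" where
  "valuation_on K v \<longleftrightarrow>
     (\<forall>x\<in>K - {0}. \<forall>y\<in>K - {0}. v (x * y) = v x + v y) \<and>
     (\<forall>x\<in>K - {0}. \<forall>y\<in>K - {0}. x + y \<noteq> 0 \<longrightarrow> min (v x) (v y) \<le> v (x + y))"

definition Z_valuation :: "('b::field \<Rightarrow> int) \<Rightarrow> bool" where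
  "Z_valuation v \<longleftrightarrow> valuation_on UNIV v \<and> v ` (UNIV - {0}) = UNIV"

text \<open>
  Up to isomorphism over the base field, the finite extensions are the intermediate fields of
  the algebraic closure that have finite dimension over the base field.
\<close>

definition finite_extension :: "'a::field alg_closure set \<Rightarrow> bool" where
  "finite_extension K \<longleftrightarrow>
     subfield K ring_of_type_algebra \<and> range to_ac \<subseteq> K \<and>
     ring.finite_dimension ring_of_type_algebra (range to_ac) K"

text \<open>
  The value group of an extension of a \<open>\<int>\<close>-valuation to a finite field extension contains \<open>\<int>\<close> with
  finite index, so it embeds into \<open>\<rat>\<close> in a unique way over \<open>\<int>\<close>. Hence the extensions up to
  equivalence are exactly the rational-valued valuations that restrict to the given one.
\<close>

definition extends_to :: "('a::field \<Rightarrow> int) \<Rightarrow> 'a alg_closure set \<Rightarrow> ('a alg_closure \<Rightarrow> rat) \<Rightarrow> bool" where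
  "extends_to v K u \<longleftrightarrow> valuation_on K u \<and> (\<forall>c. c \<noteq> 0 \<longrightarrow> u (to_ac c) = of_int (v c))"

definition henselian :: "('a::field \<Rightarrow> int) \<Rightarrow> bool" where
  "henselian v \<longleftrightarrow>
     (\<forall>K. finite_extension K \<longrightarrow>
        (\<exists>u. extends_to v K u \<and> (\<forall>u'. extends_to v K u' \<longrightarrow> (\<forall>x\<in>K - {0}. u' x = u x))))"


section \<open>Residue fields and separably closed fields\<close>

definition valuation_ring :: "('b::field \<Rightarrow> int) \<Rightarrow> 'b ring" where
  "valuation_ring v = ring_of_type_algebra\<lparr>carrier := {x. x = 0 \<or> 0 \<le> v x}\<rparr>"

definition valuation_ideal :: "('b::field \<Rightarrow> int) \<Rightarrow> 'b set" where
  "valuation_ideal v = {x. x = 0 \<or> 0 < v x}"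

definition residue_field :: "('b::field \<Rightarrow> int) \<Rightarrow> 'b set ring" where
  "residue_field v = valuation_ring v Quot valuation_ideal v"

text \<open>Polynomials in \<open>poly_ring\<close> are lists of coefficients with the leading coefficient first.\<close>

definition formal_deriv :: "('c, 'd) ring_scheme \<Rightarrow> 'c list \<Rightarrow> 'c list" where
  "formal_deriv R p =
     ring.normalize R (map (\<lambda>i. add_pow R i (ring.coeff R p i)) (rev [1..<length p]))"

definition separable_poly :: "('c, 'd) ring_scheme \<Rightarrow> 'c list \<Rightarrow> bool" where
  "separable_poly R p \<longleftrightarrow>
     (\<exists>s\<in>carrier (poly_ring R). \<exists>t\<in>carrier (poly_ring R).
        s \<otimes>\<^bsub>poly_ring R\<^esub> p \<oplus>\<^bsub>poly_ring R\<^esub> t \<otimes>\<^bsub>poly_ring R\<^esub> formal_deriv R p = \<one>\<^bsub>poly_ring R\<^esub>)"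

definition separably_closed :: "('c, 'd) ring_scheme \<Rightarrow> bool" where
  "separably_closed R \<longleftrightarrow>
     (\<forall>p\<in>carrier (poly_ring R). separable_poly R p \<longrightarrow> ring.splitted R p)"


section \<open>Completion with respect to a \<open>\<int>\<close>-valuation\<close>

text \<open>The completion is the ring of Cauchy sequences modulo the ideal of null sequences.\<close>

definition val_Cauchy :: "('b::field \<Rightarrow> int) \<Rightarrow> (nat \<Rightarrow> 'b) \<Rightarrow> bool" where
  "val_Cauchy w s \<longleftrightarrow> (\<forall>n. \<exists>N. \<forall>i\<ge>N. \<forall>j\<ge>N. s i = s j \<or> n \<le> w (s i - s j))"

definition val_null :: "('b::field \<Rightarrow> int) \<Rightarrow> (nat \<Rightarrow> 'b) \<Rightarrow> bool" where
  "val_null w s \<longleftrightarrow> (\<forall>n. \<exists>N. \<forall>i\<ge>N. s i = 0 \<or> n \<le> w (s i))"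

definition Cauchy_ring :: "('b::field \<Rightarrow> int) \<Rightarrow> (nat \<Rightarrow> 'b) ring" where
  "Cauchy_ring w =
     \<lparr>carrier = {s. val_Cauchy w s},
      monoid.mult = (\<lambda>s t i. s i * t i), one = (\<lambda>i. 1),
      ring.zero = (\<lambda>i. 0), add = (\<lambda>s t i. s i + t i)\<rparr>"

definition completion :: "('b::field \<Rightarrow> int) \<Rightarrow> (nat \<Rightarrow> 'b) set ring" where
  "completion w = Cauchy_ring w Quot {s. val_null w s}"

definition to_completion :: "('b::field \<Rightarrow> int) \<Rightarrow> 'b \<Rightarrow> (nat \<Rightarrow> 'b) set" where
  "to_completion w x = {s. val_null w s} +>\<^bsub>Cauchy_ring w\<^esub> (\<lambda>i. x)"


section \<open>Diagonal quadratic forms\<close>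

definition diag_form :: "('c, 'd) ring_scheme \<Rightarrow> 'c list \<Rightarrow> 'c list \<Rightarrow> 'c" where
  "diag_form R as ys =
     (\<Oplus>\<^bsub>R\<^esub>i\<in>{..<length as}. as ! i \<otimes>\<^bsub>R\<^esub> (ys ! i [^]\<^bsub>R\<^esub> (2::nat)))"

definition isotropic :: "('c, 'd) ring_scheme \<Rightarrow> 'c list \<Rightarrow> bool" where
  "isotropic R as \<longleftrightarrow>
     (\<exists>ys. length ys = length as \<and> set ys \<subseteq> carrier R \<and>
        (\<exists>y\<in>set ys. y \<noteq> \<zero>\<^bsub>R\<^esub>) \<and> diag_form R as ys = \<zero>\<^bsub>R\<^esub>)"

abbreviation anisotropic :: "('c, 'd) ring_scheme \<Rightarrow> 'c list \<Rightarrow> bool" where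
  "anisotropic R as \<equiv> \<not> isotropic R as"


section \<open>The rational function field\<close>

definition rf_const :: "'a::field \<Rightarrow> 'a poly fract" where
  "rf_const c = to_fract [:c:]"

definition rf_X :: "'a::field poly fract" where
  "rf_X = to_fract [:0, 1:]"

definition Omega :: "nat \<Rightarrow> ('a::field poly fract \<Rightarrow> int) set" where
  "Omega m =
     {w. Z_valuation w \<and>
         (\<exists>i\<le>m. (\<lambda>c. w (rf_const c)) ` (UNIV - {0}) = range (\<lambda>k. int i * k))}"

definition phi :: "'a::field \<Rightarrow> nat \<Rightarrow> 'a poly fract list" where
  "phi p r =
     [rf_X ^ r - rf_const p,
      rf_X ^ (r + 1) + rf_const p,
      rf_const p * rf_X,
      rf_X * (rf_X ^ r + rf_const p)]"

end

theory Submission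
  imports Defs
begin

text \<open>
  Since \<open>\<kappa>\<^sub>v\<close> is separably closed and \<open>v\<close> is henselian with \<open>v 2 = 0\<close>, every \<open>v\<close>-unit of a finite
  extension \<open>K\<close> of \<open>E\<close> is a square, and as finitely generated subgroups of \<open>\<rat>\<close> are cyclic,
  \<open>K\<close> has at most two square classes. In particular \<open>-1\<close> is a square, and a valuation \<open>w\<close> on
  \<open>E(X)\<close> restricts to \<open>i v\<close> on \<open>E\<close> with \<open>i = w \<pi>\<close>.

  If \<open>i < r\<close>, two coefficients of the form have ratio \<open>-1\<close> up to a square modulo the maximal ideal
  of \<open>w\<close>, which gives an isotropic vector by Newton iteration: for \<open>w X > 0\<close> both
  \<open>-(X^r - \<pi>)\<close> and \<open>X^(r+1) + \<pi>\<close> are dominated by \<open>\<pi>\<close>; for \<open>w X \<le> 0\<close> and \<open>(i, w X) \<noteq> (0, 0)\<close>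
  both \<open>X^(r+1) + \<pi>\<close> and \<open>X (X^r + \<pi>)\<close> are dominated by \<open>X^(r+1)\<close>; and if \<open>i = w X = 0\<close>,
  then \<open>w\<close> is a closed point of the affine line at which at least three coefficients are units, and
  its residue field has at most two square classes.

  For the second claim take \<open>w (\<Sum>c\<^sub>j X^j) = min (r v c\<^sub>j + j)\<close>. Refining it by the largest index
  at which the minimum is attained, that is, by the degree valuation of the residue field
  \<open>\<kappa>\<^sub>v(X^r/\<pi>)\<close>, gives the four terms of the form pairwise distinct values.
\<close>

section \<open>Valuations on subfields\<close>

locale valued_field =
  fixes K :: "'b::field set" and v :: "'b \<Rightarrow> 'g::linordered_ab_group_add"
  assumes valuation: "valuation_on K v"
    and one_closed: "1 \<in> K"
    and diff_closed: "x \<in> K \<Longrightarrow> y \<in> K \<Longrightarrow> x - y \<in> K"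
    and mult_closed: "x \<in> K \<Longrightarrow> y \<in> K \<Longrightarrow> x * y \<in> K"
    and inverse_closed: "x \<in> K \<Longrightarrow> inverse x \<in> K"
begin

definition val_ge :: "'g \<Rightarrow> 'b \<Rightarrow> bool" where
  "val_ge n x \<longleftrightarrow> x = 0 \<or> n \<le> v x"

definition val_gt :: "'g \<Rightarrow> 'b \<Rightarrow> bool" where
  "val_gt n x \<longleftrightarrow> x = 0 \<or> n < v x"

lemma zero_closed: "0 \<in> K"
  using diff_closed[OF one_closed one_closed] by simp

lemma uminus_closed: "x \<in> K \<Longrightarrow> - x \<in> K"
  using diff_closed[OF zero_closed] by simp

lemma add_closed: "x \<in> K \<Longrightarrow> y \<in> K \<Longrightarrow> x + y \<in> K"
  using diff_closed[OF _ uminus_closed] by simp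

lemma divide_closed: "x \<in> K \<Longrightarrow> y \<in> K \<Longrightarrow> x / y \<in> K"
  by (simp add: divide_inverse mult_closed inverse_closed)

lemma power_closed: "x \<in> K \<Longrightarrow> x ^ n \<in> K"
  by (induction n) (auto simp: one_closed mult_closed)

lemma sum_closed: "(\<And>i. i \<in> A \<Longrightarrow> f i \<in> K) \<Longrightarrow> sum f A \<in> K"
  by (induction A rule: infinite_finite_induct) (auto simp: zero_closed add_closed)

lemmas closed = one_closed zero_closed diff_closed mult_closed inverse_closed uminus_closed
  add_closed divide_closed power_closed

lemma val_mult: "x \<in> K \<Longrightarrow> y \<in> K \<Longrightarrow> x \<noteq> 0 \<Longrightarrow> y \<noteq> 0 \<Longrightarrow> v (x * y) = v x + v y"
  using valuation by (auto simp: valuation_on_def)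

lemma val_add: "x \<in> K \<Longrightarrow> y \<in> K \<Longrightarrow> x \<noteq> 0 \<Longrightarrow> y \<noteq> 0 \<Longrightarrow> x + y \<noteq> 0 \<Longrightarrow>
    min (v x) (v y) \<le> v (x + y)"
  using valuation by (auto simp: valuation_on_def)

lemma val_one: "v 1 = 0"
  using val_mult[OF one_closed one_closed] by simp

lemma val_uminus_one: "v (- 1) = 0"
  using val_mult[OF uminus_closed uminus_closed, OF one_closed one_closed] val_one
  by (simp add: double_zero)

lemma val_uminus: "x \<in> K \<Longrightarrow> v (- x) = v x"
  using val_mult[OF uminus_closed[OF one_closed], of x] val_uminus_one by (cases "x = 0") auto

lemma val_inverse: "x \<in> K \<Longrightarrow> x \<noteq> 0 \<Longrightarrow> v (inverse x) = - v x"
  using val_mult[OF _ inverse_closed, of x x] val_one by (simp add: eq_neg_iff_add_eq_0 add.commute)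

lemma val_divide: "x \<in> K \<Longrightarrow> y \<in> K \<Longrightarrow> x \<noteq> 0 \<Longrightarrow> y \<noteq> 0 \<Longrightarrow> v (x / y) = v x - v y"
  by (simp add: divide_inverse val_mult inverse_closed val_inverse)

lemma val_power_unit: "x \<in> K \<Longrightarrow> x \<noteq> 0 \<Longrightarrow> v x = 0 \<Longrightarrow> v (x ^ n) = 0"
  by (induction n) (auto simp: val_one val_mult closed)

lemma val_ge_zero [simp]: "val_ge n 0" by (simp add: val_ge_def)
lemma val_gt_zero [simp]: "val_gt n 0" by (simp add: val_gt_def)
lemma val_gt_imp_ge: "val_gt n x \<Longrightarrow> val_ge n x" by (auto simp: val_ge_def val_gt_def)
lemma val_ge_one: "val_ge 0 1" by (simp add: val_ge_def val_one)

lemma val_ge_uminus: "x \<in> K \<Longrightarrow> val_ge n (- x) \<longleftrightarrow> val_ge n x"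
  by (simp add: val_ge_def val_uminus)

lemma val_gt_uminus: "x \<in> K \<Longrightarrow> val_gt n (- x) \<longleftrightarrow> val_gt n x"
  by (simp add: val_gt_def val_uminus)

lemma val_ge_add: "x \<in> K \<Longrightarrow> y \<in> K \<Longrightarrow> val_ge n x \<Longrightarrow> val_ge n y \<Longrightarrow> val_ge n (x + y)"
  using val_add[of x y] by (cases "x = 0"; cases "y = 0"; cases "x + y = 0") (auto simp: val_ge_def min_le_iff_disj)

lemma val_gt_add: "x \<in> K \<Longrightarrow> y \<in> K \<Longrightarrow> val_gt n x \<Longrightarrow> val_gt n y \<Longrightarrow> val_gt n (x + y)"
  using val_add[of x y] by (cases "x = 0"; cases "y = 0"; cases "x + y = 0") (auto simp: val_gt_def min_le_iff_disj)

lemma val_ge_diff: "x \<in> K \<Longrightarrow> y \<in> K \<Longrightarrow> val_ge n x \<Longrightarrow> val_ge n y \<Longrightarrow> val_ge n (x - y)"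
  using val_ge_add[of x "- y"] by (simp add: val_ge_uminus closed)

lemma val_gt_diff: "x \<in> K \<Longrightarrow> y \<in> K \<Longrightarrow> val_gt n x \<Longrightarrow> val_gt n y \<Longrightarrow> val_gt n (x - y)"
  using val_gt_add[of x "- y"] by (simp add: val_gt_uminus closed)

lemma val_ge_mult: "x \<in> K \<Longrightarrow> y \<in> K \<Longrightarrow> val_ge m x \<Longrightarrow> val_ge n y \<Longrightarrow> val_ge (m + n) (x * y)"
  by (cases "x = 0"; cases "y = 0") (auto simp: val_ge_def val_mult add_mono)

lemma val_gt_mult: "x \<in> K \<Longrightarrow> y \<in> K \<Longrightarrow> val_ge m x \<Longrightarrow> val_gt n y \<Longrightarrow> val_gt (m + n) (x * y)"
  by (cases "x = 0"; cases "y = 0") (auto simp: val_ge_def val_gt_def val_mult add_le_less_mono)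

lemma val_ge_mult_int: "x \<in> K \<Longrightarrow> y \<in> K \<Longrightarrow> val_ge 0 x \<Longrightarrow> val_ge 0 y \<Longrightarrow> val_ge 0 (x * y)"
  using val_ge_mult[of x y 0 0] by simp

lemma val_gt_mult_int:
  assumes "x \<in> K" "y \<in> K" "val_ge 0 x" "val_gt 0 y"
  shows "val_gt 0 (x * y)" "val_gt 0 (y * x)"
  using val_gt_mult[of x y 0 0] assms by (simp_all add: mult.commute)

lemma val_ge_sum: "(\<And>i. i \<in> A \<Longrightarrow> f i \<in> K) \<Longrightarrow> (\<And>i. i \<in> A \<Longrightarrow> val_ge n (f i)) \<Longrightarrow> val_ge n (sum f A)"
  by (induction A rule: infinite_finite_induct) (auto simp: sum_closed val_ge_add)

lemma val_gt_sum: "(\<And>i. i \<in> A \<Longrightarrow> f i \<in> K) \<Longrightarrow> (\<And>i. i \<in> A \<Longrightarrow> val_gt n (f i)) \<Longrightarrow> val_gt n (sum f A)"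
  by (induction A rule: infinite_finite_induct) (auto simp: sum_closed val_gt_add)

lemma val_ge_power: "x \<in> K \<Longrightarrow> val_ge 0 x \<Longrightarrow> val_ge 0 (x ^ n)"
  by (induction n) (auto simp: val_ge_one val_ge_mult_int closed)

lemma val_ge_of_nat: "of_nat n \<in> K" "val_ge 0 (of_nat n)"
  by (induction n) (auto simp: closed intro!: val_ge_add val_ge_one)

lemma val_add_gt:
  assumes "x \<in> K" "y \<in> K" "x \<noteq> 0" "val_gt (v x) y"
  shows "x + y \<noteq> 0" "v (x + y) = v x"
proof -
  show *: "x + y \<noteq> 0"
    using assms val_uminus[of x] by (auto simp: val_gt_def add_eq_0_iff)
  have "v x \<le> v (x + y)"
    using val_add[of x y] assms * by (cases "y = 0") (auto simp: val_gt_def)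
  moreover have "v (x + y) \<le> v x"
  proof (rule ccontr)
    assume "\<not> v (x + y) \<le> v x"
    hence "val_gt (v x) (x + y - y)"
      using assms by (intro val_gt_diff) (auto simp: closed val_gt_def)
    thus False using assms by (simp add: val_gt_def)
  qed
  ultimately show "v (x + y) = v x" by simp
qed

lemma val_gt_mult_cases:
  assumes "x \<in> K" "y \<in> K" "val_gt 0 (x * y)" "val_ge 0 x" "val_ge 0 y"
  shows "val_gt 0 x \<or> val_gt 0 y"
  using assms by (cases "x = 0"; cases "y = 0") (auto simp: val_gt_def val_ge_def val_mult)

lemma val_gt_cong:
  assumes "x \<in> K" "y \<in> K" "val_gt n (x - y)"
  shows "val_gt n x \<longleftrightarrow> val_gt n y"
  using val_gt_add[of "x - y" y n] val_gt_diff[of x "x - y" n] assms by (auto simp: closed)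

end

lemma Z_valuation_valued_field: "Z_valuation v \<Longrightarrow> valued_field UNIV v"
  by (simp add: Z_valuation_def valued_field_def)

section \<open>The residue field\<close>

locale residue_map = valued_field UNIV v for v :: "'a::field \<Rightarrow> int"
begin

abbreviation Ov where "Ov \<equiv> valuation_ring v"
abbreviation \<kappa> where "\<kappa> \<equiv> residue_field v"
abbreviation res where "res \<equiv> (+>\<^bsub>Ov\<^esub>) (valuation_ideal v)"

lemma valuation_ring_simps [simp]:
  "x \<in> carrier Ov \<longleftrightarrow> val_ge 0 x" "x \<otimes>\<^bsub>Ov\<^esub> y = x * y" "x \<oplus>\<^bsub>Ov\<^esub> y = x + y"
  "\<zero>\<^bsub>Ov\<^esub> = 0" "\<one>\<^bsub>Ov\<^esub> = 1"
  by (auto simp: valuation_ring_def ring_of_type_algebra_def val_ge_def)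

lemma mem_valuation_ideal [simp]: "x \<in> valuation_ideal v \<longleftrightarrow> val_gt 0 x"
  by (auto simp: valuation_ideal_def val_gt_def)

lemma cring_O: "cring Ov"
proof (rule cringI)
  show "abelian_group Ov"
  proof (rule abelian_groupI)
    fix x assume "x \<in> carrier Ov"
    thus "\<exists>y\<in>carrier Ov. y \<oplus>\<^bsub>Ov\<^esub> x = \<zero>\<^bsub>Ov\<^esub>"
      by (intro bexI[of _ "- x"]) (auto simp: val_ge_uminus)
  qed (auto intro: val_ge_add)
  show "comm_monoid Ov"
    by unfold_locales (auto simp: val_ge_one intro: val_ge_mult_int)
qed (auto simp: algebra_simps)

lemma a_inv_O: "val_ge 0 x \<Longrightarrow> \<ominus>\<^bsub>Ov\<^esub> x = - x"
proof -
  assume x: "val_ge 0 x"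
  interpret cring Ov by (rule cring_O)
  show ?thesis
    by (rule minus_equality) (use x in \<open>auto simp: val_ge_uminus\<close>)
qed

lemma primeideal: "primeideal (valuation_ideal v) Ov"
proof -
  interpret Ov: cring Ov by (rule cring_O)
  show ?thesis
  proof (rule primeidealI)
    show "ideal (valuation_ideal v) Ov"
    proof (rule idealI)
      show "subgroup (valuation_ideal v) (add_monoid Ov)"
      proof (rule Ov.add.subgroupI)
        show "valuation_ideal v \<noteq> {}"
          by (metis empty_iff mem_valuation_ideal val_gt_zero)
      qed (auto simp: a_inv_O val_gt_imp_ge val_gt_uminus intro: val_gt_imp_ge val_gt_add)
    qed (auto intro: val_gt_mult_int Ov.ring_axioms)
    show "carrier Ov \<noteq> valuation_ideal v"
    proof
      assume "carrier Ov = valuation_ideal v"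
      hence "1 \<in> carrier Ov \<longleftrightarrow> 1 \<in> valuation_ideal v" by simp
      thus False using val_ge_one by (auto simp: val_gt_def val_one)
    qed
    show "a \<in> valuation_ideal v \<or> b \<in> valuation_ideal v"
      if "a \<in> carrier Ov" "b \<in> carrier Ov" "a \<otimes>\<^bsub>Ov\<^esub> b \<in> valuation_ideal v" for a b
      using that val_gt_mult_cases[of a b] by auto
  qed (rule cring_O)
qed

sublocale I: primeideal "valuation_ideal v" Ov
  by (rule primeideal)

sublocale kap: domain \<kappa>
  unfolding residue_field_def by (rule I.quotient_is_domain)

sublocale res: ring_hom_cring Ov \<kappa> res
  unfolding residue_field_def by (rule I.rcos_ring_hom_cring)

lemma res_eq_zero_iff: "val_ge 0 x \<Longrightarrow> res x = \<zero>\<^bsub>\<kappa>\<^esub> \<longleftrightarrow> val_gt 0 x"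
  using I.quotient_eq_iff_same_a_r_cos[OF I.is_ideal, of x 0] I.a_rcos_zero[OF I.is_ideal, of 0]
  by (auto simp: residue_field_def FactRing_def a_minus_def a_inv_O)

lemma res_eq_iff: "val_ge 0 x \<Longrightarrow> val_ge 0 y \<Longrightarrow> res x = res y \<longleftrightarrow> val_gt 0 (x - y)"
  using I.quotient_eq_iff_same_a_r_cos[OF I.is_ideal, of x y]
  by (auto simp: a_minus_def a_inv_O)

lemma res_surj: "z \<in> carrier \<kappa> \<Longrightarrow> \<exists>x. val_ge 0 x \<and> z = res x"
  by (auto simp: residue_field_def FactRing_def A_RCOSETS_def' )

lemma res_closed: "val_ge 0 x \<Longrightarrow> res x \<in> carrier \<kappa>"
  by (rule res.hom_closed) simp

lemma finsum_O: "finite A \<Longrightarrow> (\<And>i. i \<in> A \<Longrightarrow> val_ge 0 (f i)) \<Longrightarrow> finsum Ov f A = sum f A"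
  by (induction A rule: finite_induct) (auto simp: I.finsum_insert)

lemma add_pow_res: "val_ge 0 x \<Longrightarrow> add_pow \<kappa> (n::nat) (res x) = res (of_nat n * x)"
proof (induction n)
  case (Suc n)
  hence "add_pow \<kappa> (Suc n) (res x) = res (of_nat n * x) \<oplus>\<^bsub>\<kappa>\<^esub> res x"
    by (simp add: kap.add.nat_pow_Suc)
  also have "\<dots> = res (of_nat n * x \<oplus>\<^bsub>Ov\<^esub> x)"
    using Suc by (intro res.hom_add[symmetric]) (auto intro!: val_ge_mult_int val_ge_of_nat)
  finally show ?case by (simp add: algebra_simps)
qed (use res.hom_zero in simp)

definition integral :: "'a poly \<Rightarrow> bool" where
  "integral f \<longleftrightarrow> (\<forall>i. val_ge 0 (coeff f i))"

definition res_poly :: "'a poly \<Rightarrow> 'a set list" where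
  "res_poly f = kap.normalize (map res (rev (coeffs f)))"

lemma coeff_map_res:
  "kap.coeff (map res xs) i = res (coeff (Poly (rev xs)) i)"
  by (induction xs) (auto simp: Poly_append coeff_monom nth_default_def Polynomial.coeff_eq_0 coeff_Poly_eq res.hom_zero[simplified])

lemma eval_map_res:
  assumes "\<forall>x\<in>set xs. val_ge 0 x" "val_ge 0 c"
  shows "kap.eval (map res xs) (res c) = res (poly (Poly (rev xs)) c) \<and>
    val_ge 0 (poly (Poly (rev xs)) c)"
  using assms(1)
proof (induction xs)
  case Nil thus ?case by (simp add: res.hom_zero[simplified])
next
  case (Cons a xs)
  have *: "res c [^]\<^bsub>\<kappa>\<^esub> n = res (c ^ n)" for n
  proof (induction n)
    case 0 thus ?case using res.hom_one by simp
  next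
    case (Suc n)
    have "res (c ^ n) \<otimes>\<^bsub>\<kappa>\<^esub> res c = res (c ^ n \<otimes>\<^bsub>Ov\<^esub> c)"
      using assms(2) by (intro res.hom_mult[symmetric]) (auto intro: val_ge_power)
    thus ?case using Suc by (simp add: mult.commute)
  qed
  have v: "val_ge 0 (a * c ^ length xs)"
    using Cons.prems assms(2) by (auto intro!: val_ge_mult_int val_ge_power)
  have "kap.eval (map res (a # xs)) (res c) =
      res a \<otimes>\<^bsub>\<kappa>\<^esub> res (c ^ length xs) \<oplus>\<^bsub>\<kappa>\<^esub> res (poly (Poly (rev xs)) c)"
    using Cons by (simp add: *)
  also have "res a \<otimes>\<^bsub>\<kappa>\<^esub> res (c ^ length xs) = res (a * c ^ length xs)"
    using res.hom_mult[of a "c ^ length xs"] Cons.prems assms(2) by (auto intro: val_ge_power)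
  also have "\<dots> \<oplus>\<^bsub>\<kappa>\<^esub> res (poly (Poly (rev xs)) c) = 
     res (a * c ^ length xs + poly (Poly (rev xs)) c)"
    using res.hom_add[of "a * c ^ length xs" "poly (Poly (rev xs)) c"] v Cons by simp
  finally show ?case
    using v Cons by (auto simp: Poly_append poly_monom algebra_simps intro: val_ge_add)
qed

lemma integral_coeffs: "integral f \<Longrightarrow> x \<in> set (coeffs f) \<Longrightarrow> val_ge 0 x"
  by (auto simp: integral_def coeffs_def split: if_splits)

lemma set_map_res: "integral f \<Longrightarrow> set (map res (rev (coeffs f))) \<subseteq> carrier \<kappa>"
  using integral_coeffs res_closed by auto

lemma coeff_res_poly: "kap.coeff (res_poly f) i = res (coeff f i)"
  by (simp add: res_poly_def kap.normalize_coeff[symmetric] coeff_map_res)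

lemma res_poly_polynomial: "integral f \<Longrightarrow> polynomial\<^bsub>\<kappa>\<^esub> (carrier \<kappa>) (res_poly f)"
  unfolding res_poly_def by (rule kap.normalize_gives_polynomial[OF set_map_res])

lemma set_res_poly: "integral f \<Longrightarrow> set (res_poly f) \<subseteq> carrier \<kappa>"
  by (rule kap.polynomial_incl[OF res_poly_polynomial])

lemma res_poly_carrier: "integral f \<Longrightarrow> res_poly f \<in> carrier (poly_ring \<kappa>)"
  using res_poly_polynomial by (simp add: univ_poly_def)

lemma eval_res_poly:
  assumes "integral f" "val_ge 0 c"
  shows "kap.eval (res_poly f) (res c) = res (poly f c)" "val_ge 0 (poly f c)"
  using eval_map_res[of "rev (coeffs f)" c] integral_coeffs[OF assms(1)] assms
    kap.eval_normalize[OF set_map_res res_closed]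
  by (auto simp: res_poly_def)

lemma res_poly_eqI:
  assumes "polynomial\<^bsub>\<kappa>\<^esub> (carrier \<kappa>) p" "integral f" "\<And>i. kap.coeff p i = res (coeff f i)"
  shows "p = res_poly f"
  using kap.coeff_iff_polynomial_cond[OF assms(1) res_poly_polynomial[OF assms(2)]] assms(3)
  by (auto simp: coeff_res_poly)

lemma integral_mult: "integral f \<Longrightarrow> integral g \<Longrightarrow> integral (f * g)"
  by (auto simp: integral_def coeff_mult intro!: val_ge_sum val_ge_mult_int)

lemma integral_add: "integral f \<Longrightarrow> integral g \<Longrightarrow> integral (f + g)"
  by (auto simp: integral_def intro!: val_ge_add)

lemma integral_diff: "integral f \<Longrightarrow> integral g \<Longrightarrow> integral (f - g)"
  by (auto simp: integral_def intro!: val_ge_diff)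

lemma integral_pderiv: "integral f \<Longrightarrow> integral (pderiv f)"
  unfolding integral_def coeff_pderiv
  by (intro allI val_ge_mult_int) (auto simp: val_ge_of_nat simp del: of_nat_Suc)

lemma integral_const: "integral [:c:] \<longleftrightarrow> val_ge 0 c"
  by (auto simp: integral_def coeff_pCons split: nat.splits)

lemma res_poly_mult:
  assumes "integral f" "integral g"
  shows "res_poly f \<otimes>\<^bsub>poly_ring \<kappa>\<^esub> res_poly g = res_poly (f * g)"
proof (rule res_poly_eqI)
  note [simp] = kap.carrier_is_subring
  have s: "set (res_poly f) \<subseteq> carrier \<kappa>" "set (res_poly g) \<subseteq> carrier \<kappa>"
    using set_res_poly assms by auto
  show "polynomial\<^bsub>\<kappa>\<^esub> (carrier \<kappa>) (res_poly f \<otimes>\<^bsub>poly_ring \<kappa>\<^esub> res_poly g)"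
    unfolding univ_poly_mult using s by (intro kap.poly_mult_is_polynomial) auto
  have int: "val_ge 0 (coeff f k * coeff g (i - k))" for k i
    using assms by (auto simp: integral_def intro: val_ge_mult_int)
  show "kap.coeff (res_poly f \<otimes>\<^bsub>poly_ring \<kappa>\<^esub> res_poly g) i = res (coeff (f * g) i)" for i
  proof -
    have "kap.coeff (res_poly f \<otimes>\<^bsub>poly_ring \<kappa>\<^esub> res_poly g) i =
        (\<Oplus>\<^bsub>\<kappa>\<^esub>k\<in>{..i}. res (coeff f k) \<otimes>\<^bsub>\<kappa>\<^esub> res (coeff g (i - k)))"
      unfolding univ_poly_mult by (simp add: kap.poly_mult_coeff[OF s] coeff_res_poly)
    also have "\<dots> = (\<Oplus>\<^bsub>\<kappa>\<^esub>k\<in>{..i}. res (coeff f k * coeff g (i - k)))"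
      using assms by (intro kap.finsum_cong' refl) (auto simp: integral_def res.hom_mult[simplified] int res_closed)
    also have "\<dots> = res (finsum Ov (\<lambda>k. coeff f k * coeff g (i - k)) {..i})"
      by (subst res.hom_finsum) (auto simp: int o_def)
    also have "\<dots> = res (coeff (f * g) i)"
      by (simp add: finsum_O int coeff_mult)
    finally show ?thesis .
  qed
qed (use assms integral_mult in auto)

lemma res_poly_add:
  assumes "integral f" "integral g"
  shows "res_poly f \<oplus>\<^bsub>poly_ring \<kappa>\<^esub> res_poly g = res_poly (f + g)"
proof (rule res_poly_eqI)
  note [simp] = kap.carrier_is_subring
  have s: "set (res_poly f) \<subseteq> carrier \<kappa>" "set (res_poly g) \<subseteq> carrier \<kappa>"
    using set_res_poly assms by auto
  show "polynomial\<^bsub>\<kappa>\<^esub> (carrier \<kappa>) (res_poly f \<oplus>\<^bsub>poly_ring \<kappa>\<^esub> res_poly g)"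
    unfolding univ_poly_add using s by (intro kap.poly_add_is_polynomial) auto
  show "kap.coeff (res_poly f \<oplus>\<^bsub>poly_ring \<kappa>\<^esub> res_poly g) i = res (coeff (f + g) i)" for i
    unfolding univ_poly_add using assms
    by (simp add: kap.poly_add_coeff[OF s] coeff_res_poly integral_def res.hom_add[simplified] del: kap.poly_add.simps)
qed (use assms integral_add in auto)

lemma coeff_map_rev_upt: "kap.coeff (map g (rev [a..<b])) i = (if i < b - a then g (i + a) else \<zero>\<^bsub>\<kappa>\<^esub>)"
  by (induction b) (auto simp: not_less less_Suc_eq Suc_diff_le)

lemma formal_deriv_res_poly:
  assumes "integral f"
  shows "formal_deriv \<kappa> (res_poly f) = res_poly (pderiv f)"
proof (rule res_poly_eqI)
  have "set (res_poly f) \<subseteq> carrier \<kappa>"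
    using assms by (rule set_res_poly)
  thus "polynomial\<^bsub>\<kappa>\<^esub> (carrier \<kappa>) (formal_deriv \<kappa> (res_poly f))"
    unfolding formal_deriv_def by (intro kap.normalize_gives_polynomial) auto
  show "kap.coeff (formal_deriv \<kappa> (res_poly f)) i = res (coeff (pderiv f) i)" for i
  proof -
    have "kap.coeff (formal_deriv \<kappa> (res_poly f)) i =
        (if i < length (res_poly f) - 1 then add_pow \<kappa> (Suc i) (res (coeff f (Suc i))) else \<zero>\<^bsub>\<kappa>\<^esub>)"
      by (simp add: formal_deriv_def kap.normalize_coeff[symmetric] coeff_map_rev_upt coeff_res_poly)
    also have "\<dots> = add_pow \<kappa> (Suc i) (res (coeff f (Suc i)))"
      using kap.coeff_length[of "res_poly f" "Suc i"] by (auto simp: coeff_res_poly)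
    also have "\<dots> = res (coeff (pderiv f) i)"
      using assms by (subst add_pow_res) (auto simp: integral_def coeff_pderiv)
    finally show ?thesis .
  qed
qed (use assms integral_pderiv in auto)

theorem separably_closed_root:
  assumes sc: "separably_closed \<kappa>"
    and f: "integral f" "v (lead_coeff f) = 0" "degree f > 0"
    and s: "integral s" and t: "integral t"
    and bezout: "\<And>i. val_gt 0 (coeff (s * f + t * pderiv f - 1) i)"
  shows "\<exists>c. val_ge 0 c \<and> val_gt 0 (poly f c)"
proof -
  have int: "integral (s * f + t * pderiv f)"
    using f s t by (auto intro!: integral_add integral_mult integral_pderiv)
  have "res_poly s \<otimes>\<^bsub>poly_ring \<kappa>\<^esub> res_poly f \<oplus>\<^bsub>poly_ring \<kappa>\<^esub>
      res_poly t \<otimes>\<^bsub>poly_ring \<kappa>\<^esub> formal_deriv \<kappa> (res_poly f) = res_poly (s * f + t * pderiv f)"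
    using f s t by (simp add: formal_deriv_res_poly res_poly_mult res_poly_add integral_mult integral_pderiv)
  also have "\<dots> = res_poly 1"
  proof (rule res_poly_eqI[OF res_poly_polynomial[OF int]])
    show "kap.coeff (res_poly (s * f + t * pderiv f)) i = res (coeff 1 i)" for i
      using bezout[of i] int unfolding coeff_res_poly integral_def
      by (subst res_eq_iff) (auto simp: val_ge_one)
  qed (simp add: integral_def val_ge_one)
  also have "\<dots> = \<one>\<^bsub>poly_ring \<kappa>\<^esub>"
    using kap.one_not_zero res.hom_one by (simp add: res_poly_def univ_poly_one)
  finally have "separable_poly \<kappa> (res_poly f)"
    unfolding separable_poly_def using res_poly_carrier[OF s] res_poly_carrier[OF t] by blast
  hence split: "kap.splitted (res_poly f)"
    using sc res_poly_carrier[OF f(1)] by (auto simp: separably_closed_def)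
  have "length (res_poly f) > degree f"
  proof (rule ccontr)
    assume "\<not> length (res_poly f) > degree f"
    hence "res (lead_coeff f) = \<zero>\<^bsub>\<kappa>\<^esub>"
      using kap.coeff_length[of "res_poly f" "degree f"] by (auto simp: coeff_res_poly)
    thus False
      using f res_eq_zero_iff[of "lead_coeff f"] by (auto simp: val_ge_def val_gt_def)
  qed
  hence "kap.roots (res_poly f) \<noteq> {#}"
    using split f(3) by (auto simp: kap.splitted_def)
  then obtain z where "kap.is_root (res_poly f) z"
    using kap.roots_mem_iff_is_root[OF res_poly_carrier[OF f(1)]] by blast
  hence z: "z \<in> carrier \<kappa>" "kap.eval (res_poly f) z = \<zero>\<^bsub>\<kappa>\<^esub>"
    by (auto simp: kap.is_root_def)
  from res_surj[OF z(1)] obtain c where c: "val_ge 0 c" "z = res c" by auto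
  with z(2) eval_res_poly[OF f(1) c(1)] have "val_gt 0 (poly f c)"
    using res_eq_zero_iff by auto
  with c show ?thesis by auto
qed

end

section \<open>Polynomials modulo the maximal ideal\<close>

definition ac_poly :: "'a::field poly \<Rightarrow> 'a alg_closure \<Rightarrow> 'a alg_closure" where
  "ac_poly f x = poly (map_poly to_ac f) x"

lemma ac_poly_eq_sum: "degree f \<le> n \<Longrightarrow> ac_poly f x = (\<Sum>i\<le>n. to_ac (coeff f i) * x ^ i)"
proof -
  assume "degree f \<le> n"
  hence "degree (map_poly to_ac f) \<le> n"
    by (intro degree_le) (auto simp: coeff_map_poly coeff_eq_0)
  hence "poly (map_poly to_ac f) x = (\<Sum>i\<le>n. coeff (map_poly to_ac f) i * x ^ i)"
    unfolding poly_altdef by (intro sum.mono_neutral_left) (auto simp: coeff_eq_0)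
  thus ?thesis by (simp add: ac_poly_def coeff_map_poly)
qed

lemma ac_poly_add: "ac_poly (f + g) x = ac_poly f x + ac_poly g x"
proof -
  have "map_poly to_ac (f + g) = map_poly to_ac f + map_poly to_ac g"
    by (rule poly_eqI) (simp add: coeff_map_poly)
  thus ?thesis by (simp add: ac_poly_def)
qed

lemma ac_poly_diff: "ac_poly (f - g) x = ac_poly f x - ac_poly g x"
  using ac_poly_add[of "f - g" g x] by simp

lemma ac_poly_mult: "ac_poly (f * g) x = ac_poly f x * ac_poly g x"
proof -
  have "map_poly to_ac (f * g) = map_poly to_ac f * map_poly to_ac g"
    by (rule poly_eqI) (simp add: coeff_map_poly coeff_mult to_ac_sum)
  thus ?thesis by (simp add: ac_poly_def)
qed

lemma ac_poly_power: "ac_poly (f ^ n) x = ac_poly f x ^ n"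
  by (induction n) (auto simp: ac_poly_mult, simp add: ac_poly_def)

lemma ac_poly_const [simp]: "ac_poly [:c:] x = to_ac c"
  by (simp add: ac_poly_def map_poly_pCons)

lemma ac_poly_zero [simp]: "ac_poly 0 x = 0"
  by (simp add: ac_poly_def)

lemma ac_poly_linear [simp]: "ac_poly [:c, 1:] x = to_ac c + x"
  by (simp add: ac_poly_def map_poly_pCons)

context residue_map
begin

definition small :: "'a poly \<Rightarrow> bool" where
  "small f \<longleftrightarrow> (\<forall>i. val_gt 0 (coeff f i))"

lemma small_diff: "small f \<Longrightarrow> small g \<Longrightarrow> small (f - g)"
  by (simp add: small_def val_gt_diff)

lemma small_add: "small f \<Longrightarrow> small g \<Longrightarrow> small (f + g)"
  by (simp add: small_def val_gt_add)

lemma small_mult: "integral f \<Longrightarrow> small g \<Longrightarrow> small (f * g)"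
  by (auto simp: small_def integral_def coeff_mult intro!: val_gt_sum val_gt_mult_int(1))

lemma small_imp_integral: "small f \<Longrightarrow> integral f"
  by (simp add: small_def integral_def val_gt_imp_ge)

lemma integral_monom: "val_ge 0 c \<Longrightarrow> integral (monom c n)"
  by (simp add: integral_def)

lemma unit_lead_reduction:
  assumes "integral f" "\<not> small f"
  shows "\<exists>g. integral g \<and> g \<noteq> 0 \<and> v (lead_coeff g) = 0 \<and> degree g \<le> degree f \<and> small (f - g)"
  using assms
proof (induction "degree f" arbitrary: f rule: less_induct)
  case less
  have f0: "f \<noteq> 0" using less.prems by (auto simp: small_def)
  show ?case
  proof (cases "v (lead_coeff f) = 0")
    case True
    thus ?thesis using less.prems f0 by (intro exI[of _ f]) (auto simp: small_def)
  next
    case False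
    define h where "h = monom (lead_coeff f) (degree f)"
    have h: "small h"
      using False less.prems(1) f0
      by (auto simp: h_def small_def val_gt_def integral_def val_ge_def dest: spec[of _ "degree f"])
    define f' where "f' = f - h"
    have f': "integral f'" "\<not> small f'"
      using less.prems h small_add[of f' h] by (auto simp: f'_def small_imp_integral integral_diff)
    have "degree f > 0"
    proof (rule ccontr)
      assume "\<not> degree f > 0"
      hence "f = h" by (auto simp: h_def monom_0 elim: degree_eq_zeroE)
      thus False using less.prems h by simp
    qed
    have "degree f' < degree f"
    proof (rule degree_lessI)
      show "f' \<noteq> 0 \<or> 0 < degree f" using \<open>degree f > 0\<close> by simp
      show "\<forall>k\<ge>degree f. coeff f' k = 0"
        by (auto simp: f'_def h_def coeff_eq_0)
    qed
    from less.hyps[OF this f'] obtain g where g: "integral g" "g \<noteq> 0" "v (lead_coeff g) = 0"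
      "degree g \<le> degree f'" "small (f' - g)" by auto
    moreover have "small (f - g)"
      using small_add[OF g(5) h] by (simp add: f'_def)
    ultimately show ?thesis
      using \<open>degree f' < degree f\<close> by (intro exI[of _ g]) auto
  qed
qed

lemma integral_division:
  assumes g: "integral g" "g \<noteq> 0" "v (lead_coeff g) = 0" and "integral f"
  shows "\<exists>q r. integral q \<and> integral r \<and> f = q * g + r \<and> (r = 0 \<or> degree r < degree g)"
  using assms(4)
proof (induction "if f = 0 then 0 else Suc (degree f)" arbitrary: f rule: less_induct)
  case less
  show ?case
  proof (cases "f = 0 \<or> degree f < degree g")
    case True
    thus ?thesis using less.prems by (intro exI[of _ 0] exI[of _ f]) (auto simp: integral_def)
  next
    case False
    define m where "m = monom (lead_coeff f / lead_coeff g) (degree f - degree g)"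
    have m: "integral m"
      unfolding m_def using less.prems g False
      by (intro integral_monom)
        (auto simp: integral_def val_ge_def val_divide dest: spec[of _ "degree f"])
    define f' where "f' = f - m * g"
    have m0: "m \<noteq> 0" using False g by (auto simp: m_def)
    have deg: "degree (m * g) = degree f"
      using False g m0 by (simp add: degree_mult_eq) (simp add: m_def degree_monom_eq)
    have lc: "coeff (m * g) (degree f) = lead_coeff f"
      using lead_coeff_mult[of m g] m0 False g by (simp add: deg) (simp add: m_def degree_monom_eq)
    note deg = deg lc
    have "f' = 0 \<or> degree f' < degree f"
    proof (rule disjCI)
      assume *: "\<not> degree f' < degree f"
      have c: "coeff f' k = 0" if "k \<ge> degree f" for k
        using that deg by (cases "k = degree f") (auto simp: f'_def coeff_eq_0)
      with * show "f' = 0" using degree_lessI[of f' "degree f"] by auto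
    qed
    hence "(if f' = 0 then 0 else Suc (degree f')) < (if f = 0 then 0 else Suc (degree f))"
      using False by auto
    moreover have "integral f'" using less.prems m g by (auto simp: f'_def integral_diff integral_mult)
    ultimately obtain q r where "integral q" "integral r" "f' = q * g + r" "r = 0 \<or> degree r < degree g"
      using less.hyps by blast
    thus ?thesis
      using m by (intro exI[of _ "q + m"] exI[of _ r]) (auto simp: f'_def integral_add algebra_simps)
  qed
qed

lemma quotient_unit_lead:
  assumes f: "f \<noteq> 0" "v (lead_coeff f) = 0" and g: "integral g" "g \<noteq> 0" "v (lead_coeff g) = 0"
    and eq: "f = q * g + r" and r: "r = 0 \<or> degree r < degree g" "degree g \<le> degree f"
  shows "q \<noteq> 0" "v (lead_coeff q) = 0" "degree f = degree q + degree g"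
proof -
  show q0: "q \<noteq> 0"
    using eq r f by auto
  have d: "degree (q * g) = degree q + degree g"
    using q0 g by (simp add: degree_mult_eq)
  show deg: "degree f = degree q + degree g"
    using r(1) d degree_add_eq_left[of r "q * g"] by (auto simp: eq)
  have "lead_coeff f = lead_coeff (q * g)"
    using r(1) d deg by (auto simp: eq coeff_eq_0)
  hence "v (lead_coeff q * lead_coeff g) = 0"
    using f by (simp add: lead_coeff_mult)
  thus "v (lead_coeff q) = 0"
    using q0 g by (simp add: val_mult)
qed

lemma bezout_mod_small:
  assumes f: "integral f" and h: "integral h" "\<not> small h"
  shows "\<exists>g s t. integral g \<and> integral s \<and> integral t \<and> g \<noteq> 0 \<and> v (lead_coeff g) = 0 \<and>
    degree g \<le> degree h \<and> small (s * f + t * h - g) \<and>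
    (\<exists>q r. integral q \<and> f = q * g + r \<and> (r = 0 \<or> degree r < degree g) \<and> small r)"
proof -
  define J where "J = {g. integral g \<and> (\<exists>s t. integral s \<and> integral t \<and> small (s * f + t * h - g))}"
  have hJ: "h \<in> J"
    unfolding J_def using h
    by (intro CollectI conjI exI[of _ 0] exI[of _ 1]) (auto simp: small_def integral_def val_ge_one)
  define P where "P g \<longleftrightarrow> g \<in> J \<and> g \<noteq> 0 \<and> v (lead_coeff g) = 0" for g
  have red: "\<exists>g'. P g' \<and> degree g' \<le> degree g" if "g \<in> J" "\<not> small g" for g
  proof -
    from that obtain g' where g': "integral g'" "g' \<noteq> 0" "v (lead_coeff g') = 0"
      "degree g' \<le> degree g" "small (g - g')"
      using unit_lead_reduction[of g] by (auto simp: J_def)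
    from that obtain s t where st: "integral s" "integral t" "small (s * f + t * h - g)"
      by (auto simp: J_def)
    have "s * f + t * h - g' = (s * f + t * h - g) + (g - g')" by simp
    hence "g' \<in> J" unfolding J_def using g' st small_add by fastforce
    thus ?thesis using g' by (auto simp: P_def)
  qed
  obtain g where g: "P g" and min: "\<And>g'. P g' \<Longrightarrow> degree g \<le> degree g'"
    using red[OF hJ h(2)] exists_least_iff[of "\<lambda>n. \<exists>g. P g \<and> degree g = n"]
    by (metis not_le)
  from g have gJ: "g \<in> J" "g \<noteq> 0" "v (lead_coeff g) = 0" "integral g" by (auto simp: P_def J_def)
  from gJ(1) obtain s t where st: "integral s" "integral t" "small (s * f + t * h - g)"
    by (auto simp: J_def)
  obtain q r where qr: "integral q" "integral r" "f = q * g + r" "r = 0 \<or> degree r < degree g"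
    using integral_division[OF gJ(4,2,3) f] by blast
  have "small r"
  proof (rule ccontr)
    assume ns: "\<not> small r"
    have "small ((1 - q * s) * f + (- q * t) * h - r)"
    proof -
      have "(1 - q * s) * f + (- q * t) * h - r = 0 - q * (s * f + t * h - g)"
        using qr(3) by (simp add: algebra_simps)
      thus ?thesis using st qr by (metis small_diff small_mult small_def coeff_0 val_gt_zero)
    qed
    moreover have "integral (1 - q * s)" "integral (- q * t)"
      using st qr integral_mult[of q s] integral_mult[of q t] integral_diff[of 1 "q * s"] 
        integral_diff[of 0 "q * t"]
      by (auto simp: integral_def val_ge_one)
    ultimately have "r \<in> J" unfolding J_def using qr(2) by blast
    from red[OF this ns] obtain g' where "P g'" "degree g' \<le> degree r" by auto
    with min[of g'] qr(4) ns show False by (auto simp: small_def)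
  qed
  moreover have "degree g \<le> degree h"
    using red[OF hJ h(2)] min by (meson order_trans)
  ultimately show ?thesis using gJ st qr by blast
qed

end

section \<open>Square roots in residue fields of finite extensions\<close>

context residue_map
begin

lemma val_of_nat_coprime:
  assumes "coprime i p" "val_gt 0 (of_nat p)"
  shows "of_nat i \<noteq> (0::'a)" "v (of_nat i) = 0"
proof -
  have "\<not> val_gt 0 (of_nat i)"
  proof
    assume i: "val_gt 0 (of_nat i)"
    obtain x y where xy: "x * int i + y * int p = 1"
      using bezout_int[of "int i" "int p"] assms(1) by (metis coprime_imp_gcd_eq_1 gcd_int_int_eq of_nat_1)
    have int: "val_ge 0 (of_int z)" for z
      using val_ge_of_nat(2) by (cases z rule: int_cases2) (auto simp: val_ge_uminus)
    have "val_gt 0 (of_int x * of_nat i + of_int y * of_nat p)"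
      using i assms(2) int by (intro val_gt_add val_gt_mult_int(1)) auto
    also have "of_int x * of_nat i + of_int y * of_nat p = (of_int (x * int i + y * int p) :: 'a)"
      by simp
    finally show False by (simp add: xy val_gt_def val_one)
  qed
  thus "of_nat i \<noteq> (0::'a)" "v (of_nat i) = 0"
    using val_ge_of_nat(2)[of i] by (auto simp: val_gt_def val_ge_def)
qed

lemma residue_char:
  assumes "val_gt 0 (of_nat n)" "n > 0"
  shows "\<exists>p. prime p \<and> val_gt 0 (of_nat p)"
  using assms
proof (induction n rule: less_induct)
  case (less n)
  have "n \<noteq> 1" using less.prems by (auto simp: val_gt_def val_one)
  then obtain p where p: "prime p" "p dvd n" using prime_factor_nat by blast
  then obtain m where m: "n = p * m" by auto
  hence "val_gt 0 (of_nat p * of_nat m)" using less.prems by simp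
  hence "val_gt 0 (of_nat p) \<or> val_gt 0 (of_nat m)"
    by (intro val_gt_mult_cases) (auto simp: val_ge_of_nat)
  moreover have "m < n" "m > 0" using m less.prems p prime_gt_1_nat[of p] by auto
  ultimately show ?case using less.IH p by blast
qed

end

locale extended_valuation = residue_map v + L: valued_field K u
  for v :: "'a::field \<Rightarrow> int" and K :: "'a alg_closure set" and u :: "'a alg_closure \<Rightarrow> rat" +
  assumes to_ac_closed: "to_ac c \<in> K"
    and extends: "c \<noteq> 0 \<Longrightarrow> u (to_ac c) = of_int (v c)"
begin

lemma val_ge_to_ac: "L.val_ge 0 (to_ac c) \<longleftrightarrow> val_ge 0 c"
  by (cases "c = 0") (auto simp: L.val_ge_def val_ge_def extends)

lemma val_gt_to_ac: "L.val_gt 0 (to_ac c) \<longleftrightarrow> val_gt 0 c"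
  by (cases "c = 0") (auto simp: L.val_gt_def val_gt_def extends)

lemma ac_poly_closed: "x \<in> K \<Longrightarrow> ac_poly f x \<in> K"
  unfolding ac_poly_eq_sum[OF order_refl]
  by (intro L.sum_closed L.mult_closed to_ac_closed L.power_closed)

lemma ac_poly_integral: "x \<in> K \<Longrightarrow> L.val_ge 0 x \<Longrightarrow> integral f \<Longrightarrow> L.val_ge 0 (ac_poly f x)"
  unfolding ac_poly_eq_sum[OF order_refl] integral_def
  by (intro L.val_ge_sum L.val_ge_mult_int L.mult_closed to_ac_closed L.power_closed L.val_ge_power)
    (auto simp: val_ge_to_ac)

lemma ac_poly_small: "x \<in> K \<Longrightarrow> L.val_ge 0 x \<Longrightarrow> small f \<Longrightarrow> L.val_gt 0 (ac_poly f x)"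
  unfolding ac_poly_eq_sum[OF order_refl] small_def
  by (intro L.val_gt_sum L.val_gt_mult_int(2) L.mult_closed to_ac_closed L.power_closed L.val_ge_power)
    (auto simp: val_gt_to_ac)

lemma residue_algebraic:
  assumes "a \<in> K" "L.val_ge 0 a"
  shows "\<exists>f. integral f \<and> f \<noteq> 0 \<and> v (lead_coeff f) = 0 \<and> L.val_gt 0 (ac_poly f a)"
proof -
  obtain f :: "'a poly" where f: "f \<noteq> 0" "ac_poly f a = 0"
    using alg_closure_algebraic[of a] unfolding ac_poly_def by blast
  define S where "S = {i. coeff f i \<noteq> 0}"
  have S: "finite S" "S \<noteq> {}"
    using MOST_coeff_eq_0[of f] f(1) leading_coeff_0_iff[of f]
    by (auto simp: S_def eventually_cofinite simp del: leading_coeff_0_iff)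
  define k where "k = arg_min_on (\<lambda>i. v (coeff f i)) S"
  have k: "k \<in> S" "\<And>i. i \<in> S \<Longrightarrow> v (coeff f k) \<le> v (coeff f i)"
    unfolding k_def using arg_min_if_finite(1)[OF S] arg_min_least[OF S] by auto
  define g where "g = smult (inverse (coeff f k)) f"
  have g: "integral g"
    unfolding integral_def
  proof
    fix i show "val_ge 0 (coeff g i)"
      using k(1) k(2)[of i] by (cases "i \<in> S") (auto simp: g_def S_def val_ge_def val_mult val_inverse)
  qed
  have "coeff g k = 1" using k(1) by (simp add: g_def S_def)
  hence "\<not> small g" by (auto simp: small_def val_gt_def val_one intro!: exI[of _ k])
  from unit_lead_reduction[OF g this] obtain h where h: "integral h" "h \<noteq> 0" "v (lead_coeff h) = 0"
    "small (g - h)" by auto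
  have "g = [:inverse (coeff f k):] * f" by (simp add: g_def)
  hence "ac_poly g a = 0" using f by (simp only: ac_poly_mult) simp
  moreover have "L.val_gt 0 (ac_poly (g - h) a)" by (rule ac_poly_small[OF assms h(4)])
  ultimately have "L.val_gt 0 (ac_poly h a)"
    using L.val_gt_uminus[OF ac_poly_closed[OF assms(1)], of 0 h] by (simp add: ac_poly_diff)
  thus ?thesis using h by blast
qed

context
  assumes sc: "separably_closed \<kappa>" and two: "(2::'a) \<noteq> 0" "v 2 = 0"
begin

lemma residue_sqrt_base:
  assumes "v c = 0" "c \<noteq> 0"
  shows "\<exists>d. val_ge 0 d \<and> val_gt 0 (d\<^sup>2 - c)"
proof -
  define f where "f = [:- c, 0, 1:]"
  have f: "integral f" "v (lead_coeff f) = 0" "degree f > 0"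
    using assms by (auto simp: f_def integral_def coeff_pCons val_one val_ge_def val_uminus split: nat.splits)
  have "\<exists>d. val_ge 0 d \<and> val_gt 0 (poly f d)"
  proof (rule separably_closed_root[OF sc f])
    show "integral [:- inverse c:]" "integral [:0, inverse (2 * c):]"
      using assms two by (auto simp: integral_def coeff_pCons val_ge_def val_uminus val_mult val_inverse val_divide split: nat.splits)
    have "pderiv f = [:0, 2:]" by (simp add: f_def pderiv_pCons numeral_poly)
    hence "[:- inverse c:] * f + [:0, inverse (2 * c):] * pderiv f - 1 = 0"
      using assms two by (simp add: f_def one_pCons)
    thus "val_gt 0 (coeff ([:- inverse c:] * f + [:0, inverse (2 * c):] * pderiv f - 1) i)" for i
      by simp
  qed
  thus ?thesis by (auto simp: f_def power2_eq_square algebra_simps)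
qed

text \<open>
  For \<open>f\<close> of minimal degree, either \<open>f\<close> is separable modulo the maximal ideal, or it is a polynomial
  in \<open>X^p\<close> for the residue characteristic \<open>p\<close>; as \<open>p\<close> is odd, a square root of \<open>a^p\<close> yields one of \<open>a\<close>.
\<close>

lemma residue_sqrt_aux:
  assumes "a \<in> K" "a \<noteq> 0" "u a = 0"
    and "integral f" "f \<noteq> 0" "v (lead_coeff f) = 0" "L.val_gt 0 (ac_poly f a)"
  shows "\<exists>b\<in>K. L.val_gt 0 (b\<^sup>2 - a)"
  using assms
proof (induction "degree f" arbitrary: f a rule: less_induct)
  case (less f a)
  note a = less.prems(1-3) and f = less.prems(4-7)
  have aint: "L.val_ge 0 a" using a by (simp add: L.val_ge_def)
  show ?case
  proof (cases "\<exists>g. integral g \<and> g \<noteq> 0 \<and> v (lead_coeff g) = 0 \<and> L.val_gt 0 (ac_poly g a) \<and> degree g < degree f")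
    case True
    thus ?thesis using less.hyps a by blast
  next
    case minimal: False
    have n: "degree f > 0"
    proof (rule ccontr)
      assume "\<not> degree f > 0"
      then obtain c where "f = [:c:]" by (auto elim: degree_eq_zeroE)
      thus False using f by (auto simp: L.val_gt_def extends)
    qed
    show ?thesis
    proof (cases "small (pderiv f)")
      case True
      have sm: "val_gt 0 (of_nat i * coeff f i)" if "i > 0" for i
        using True that unfolding small_def coeff_pderiv by (cases i) auto
      have "val_gt 0 (of_nat (degree f) * lead_coeff f)" using sm[OF n] .
      hence "val_gt 0 (of_nat (degree f)) \<or> val_gt 0 (lead_coeff f)"
        using f by (intro val_gt_mult_cases) (auto simp: val_ge_of_nat integral_def)
      hence "val_gt 0 (of_nat (degree f))" using f by (auto simp: val_gt_def)
      then obtain p where p: "prime p" "val_gt 0 (of_nat p)" using residue_char n by blast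
      have "p \<noteq> 2" using p(2) two by (auto simp: val_gt_def)
      with p(1) obtain k where k: "p = 2 * k + 1"
        using prime_odd_nat[of p] prime_ge_2_nat[of p] by (auto elim: oddE)
      have nd: "val_gt 0 (coeff f i)" if "\<not> p dvd i" for i
      proof -
        have "coprime i p" using p(1) that by (metis prime_imp_coprime coprime_commute)
        note i = val_of_nat_coprime[OF this p(2)]
        have "i > 0" using that by (cases i) auto
        from sm[OF this] have "val_gt 0 (of_nat i) \<or> val_gt 0 (coeff f i)"
          using f by (intro val_gt_mult_cases) (auto simp: val_ge_of_nat integral_def)
        thus ?thesis using i by (auto simp: val_gt_def)
      qed
      have "p dvd degree f"
        using nd[of "degree f"] f by (auto simp: val_gt_def)
      then obtain m where m: "degree f = p * m" by auto
      have p1: "p > 1" using p(1) by (rule prime_gt_1_nat)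
      have mn: "m > 0" "m < degree f" using m n p1 by auto
      define g where "g = Poly (map (\<lambda>j. coeff f (p * j)) [0..<Suc m])"
      have cg: "coeff g j = coeff f (p * j)" for j
        using m p1 by (auto simp: g_def coeff_Poly_eq nth_default_def coeff_eq_0 simp del: upt_Suc)
      have dg: "degree g = m"
      proof (rule antisym)
        show "degree g \<le> m" using m p1 by (intro degree_le) (auto simp: cg coeff_eq_0)
        show "m \<le> degree g" using f by (intro le_degree) (simp add: cg flip: m)
      qed
      have lg: "lead_coeff g = lead_coeff f" by (simp add: cg dg m)
      have "ac_poly g (a ^ p) = (\<Sum>j\<le>m. to_ac (coeff f (p * j)) * a ^ (p * j))"
        using ac_poly_eq_sum[of g m "a ^ p"] by (simp add: dg cg power_mult)
      also have "\<dots> = (\<Sum>i\<in>(\<lambda>j. p * j) ` {..m}. to_ac (coeff f i) * a ^ i)"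
        using p1 by (subst sum.reindex) (auto simp: inj_on_def)
      finally have eg: "ac_poly g (a ^ p) = (\<Sum>i\<in>(\<lambda>j. p * j) ` {..m}. to_ac (coeff f i) * a ^ i)" .
      have sub: "(\<lambda>j. p * j) ` {..m} \<subseteq> {..degree f}" using m by auto
      have "ac_poly f a = (\<Sum>i\<in>{..degree f} - (\<lambda>j. p * j) ` {..m}. to_ac (coeff f i) * a ^ i) + ac_poly g (a ^ p)"
        unfolding eg ac_poly_eq_sum[of f "degree f", OF order_refl] by (rule sum.subset_diff[OF sub]) simp
      moreover have "L.val_gt 0 (\<Sum>i\<in>{..degree f} - (\<lambda>j. p * j) ` {..m}. to_ac (coeff f i) * a ^ i)"
      proof (rule L.val_gt_sum)
        fix i assume i: "i \<in> {..degree f} - (\<lambda>j. p * j) ` {..m}"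
        show "to_ac (coeff f i) * a ^ i \<in> K" using a by (intro L.closed to_ac_closed)
        have "\<not> p dvd i"
        proof
          assume "p dvd i"
          then obtain j where "i = p * j" by auto
          thus False using i m p1 by auto
        qed
        thus "L.val_gt 0 (to_ac (coeff f i) * a ^ i)"
          using a aint by (intro L.val_gt_mult_int(2)) (auto simp: val_gt_to_ac nd L.closed to_ac_closed L.val_ge_power)
      qed
      moreover have "(\<Sum>i\<in>{..degree f} - (\<lambda>j. p * j) ` {..m}. to_ac (coeff f i) * a ^ i) \<in> K"
        using a by (intro L.sum_closed L.closed to_ac_closed)
      ultimately have gp: "L.val_gt 0 (ac_poly g (a ^ p))"
        using f(4) a L.val_gt_cong[of "ac_poly f a" "ac_poly g (a ^ p)"] by (simp add: ac_poly_closed L.closed)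
      have "\<exists>b\<in>K. L.val_gt 0 (b\<^sup>2 - a ^ p)"
      proof (rule less.hyps[of g])
        show "degree g < degree f" using dg mn by simp
        show "integral g" using f by (simp add: integral_def cg)
        show "g \<noteq> 0" using dg mn by auto
      qed (use a f lg gp in \<open>auto simp: L.closed L.val_power_unit\<close>)
      then obtain b where b: "b \<in> K" "L.val_gt 0 (b\<^sup>2 - a ^ p)" by auto
      have "(b / a ^ k)\<^sup>2 - a = inverse (a ^ (2 * k)) * (b\<^sup>2 - a ^ p)"
        using a by (simp add: k power_add power_divide right_diff_distrib power_even_eq divide_inverse)
          (simp add: algebra_simps power2_eq_square)
      moreover have "L.val_gt 0 (inverse (a ^ (2 * k)) * (b\<^sup>2 - a ^ p))"
        using a b by (intro L.val_gt_mult_int(1))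
          (auto simp: L.closed L.val_ge_def L.val_inverse L.val_power_unit)
      ultimately show ?thesis using a b by (intro bexI[of _ "b / a ^ k"]) (auto simp: L.closed)
    next
      case False
      from bezout_mod_small[OF f(1) integral_pderiv[OF f(1)] False]
      obtain g s t q r where g: "integral g" "g \<noteq> 0" "v (lead_coeff g) = 0"
        "degree g \<le> degree (pderiv f)" and st: "integral s" "integral t" "small (s * f + t * pderiv f - g)"
        and qr: "integral q" "f = q * g + r" "r = 0 \<or> degree r < degree g" "small r"
        by blast
      have "degree (pderiv f) \<le> degree f - 1" by (intro degree_le) (auto simp: coeff_pderiv coeff_eq_0)
      hence dg: "degree g < degree f" using g n by linarith
      have q: "q \<noteq> 0" "v (lead_coeff q) = 0" "degree f = degree q + degree g"
        using quotient_unit_lead[OF f(2,3) g(1-3) qr(2,3)] dg by auto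
      have factor: "L.val_gt 0 (ac_poly q' a) \<or> L.val_gt 0 (ac_poly g' a)"
        if "integral q'" "integral g'" "f = q' * g' + r'" "small r'" for q' g' r'
      proof (rule L.val_gt_mult_cases)
        have "ac_poly f a - ac_poly q' a * ac_poly g' a = ac_poly r' a"
          unfolding that(3) ac_poly_add ac_poly_mult by simp
        hence "L.val_gt 0 (ac_poly f a - ac_poly q' a * ac_poly g' a)"
          using ac_poly_small[OF a(1) aint that(4)] by simp
        thus "L.val_gt 0 (ac_poly q' a * ac_poly g' a)"
          using L.val_gt_cong[of "ac_poly f a" "ac_poly q' a * ac_poly g' a" 0] f(4) a
          by (simp add: ac_poly_closed L.closed)
      qed (use a aint that in \<open>auto intro: ac_poly_closed ac_poly_integral\<close>)
      have "degree g = 0"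
      proof (rule ccontr)
        assume "degree g \<noteq> 0"
        hence "degree q < degree f" using q by simp
        with minimal q qr(1) have "\<not> L.val_gt 0 (ac_poly q a)" by blast
        with factor[OF qr(1) g(1) qr(2,4)] have "L.val_gt 0 (ac_poly g a)" by blast
        with minimal g dg show False by blast
      qed
      then obtain c where c: "g = [:c:]" by (auto elim: degree_eq_zeroE)
      hence vc: "c \<noteq> 0" "v c = 0" using g by auto
      define i where "i = [:inverse c:]"
      have i: "integral i" using vc by (simp add: i_def integral_const val_ge_def val_inverse)
      have "i * g = 1" using vc by (simp add: i_def c one_pCons)
      have "i * (s * f + t * pderiv f - g) = (i * s) * f + (i * t) * pderiv f - 1"
        using \<open>i * g = 1\<close> by (simp add: algebra_simps)
      hence sm: "small ((i * s) * f + (i * t) * pderiv f - 1)"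
        using small_mult[OF i st(3)] by simp
      have "\<exists>d. val_ge 0 d \<and> val_gt 0 (poly f d)"
        by (rule separably_closed_root[OF sc f(1,3) n, of "i * s" "i * t"])
          (use sm st i in \<open>auto simp: small_def integral_mult\<close>)
      then obtain d where d: "val_ge 0 d" "val_gt 0 (poly f d)" by auto
      define l where "l = [:- d, 1:]"
      have l: "integral l" "l \<noteq> 0" "v (lead_coeff l) = 0" "degree l = 1"
        using d by (auto simp: l_def integral_def coeff_pCons val_one val_ge_one val_ge_uminus split: nat.splits)
      obtain q r where qr: "integral q" "f = q * l + r" "r = 0 \<or> degree r < degree l"
        using integral_division[OF l(1-3) f(1)] by blast
      have "degree r = 0" using qr(3) l by auto
      then obtain e where e: "r = [:e:]" by (auto elim: degree_eq_zeroE)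
      have "poly f d = e" by (simp add: qr(2) e l_def)
      hence "small r" using d e by (auto simp: small_def coeff_pCons split: nat.splits)
      have q: "q \<noteq> 0" "v (lead_coeff q) = 0" "degree f = degree q + degree l"
        using quotient_unit_lead[OF f(2,3) l(1-3) qr(2,3)] n l(4) by auto
      hence "\<not> L.val_gt 0 (ac_poly q a)" using minimal qr(1) l(4) by auto
      with factor[OF qr(1) l(1) qr(2) \<open>small r\<close>] have al: "L.val_gt 0 (a - to_ac d)"
        by (simp add: l_def)
      have "\<not> L.val_gt 0 (to_ac d)"
        using L.val_gt_cong[OF a(1) to_ac_closed al] a by (auto simp: L.val_gt_def)
      hence "d \<noteq> 0" "v d = 0" using d(1) by (auto simp: val_gt_to_ac val_gt_def val_ge_def)
      then obtain b where b: "val_gt 0 (b\<^sup>2 - d)" using residue_sqrt_base by blast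
      have "L.val_gt 0 (to_ac (b\<^sup>2 - d))" using b unfolding val_gt_to_ac .
      hence "L.val_gt 0 (to_ac (b\<^sup>2 - d) - (a - to_ac d))"
        by (rule L.val_gt_diff[OF to_ac_closed L.diff_closed[OF a(1) to_ac_closed] _ al])
      thus ?thesis using to_ac_closed[of b] by (auto intro!: bexI[of _ "to_ac b"])
    qed
  qed
qed

theorem residue_sqrt:
  assumes "a \<in> K" "a \<noteq> 0" "u a = 0"
  shows "\<exists>b\<in>K. L.val_gt 0 (b\<^sup>2 - a)"
  using residue_algebraic[of a] residue_sqrt_aux assms by (auto simp: L.val_ge_def)

end
end

section \<open>Square classes of finite extensions\<close>

lemma subfield_iff:
  fixes K :: "'b::field set"
  shows "subfield K ring_of_type_algebra \<longleftrightarrow>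
    1 \<in> K \<and> (\<forall>x\<in>K. \<forall>y\<in>K. x - y \<in> K \<and> x * y \<in> K) \<and> (\<forall>x\<in>K. inverse x \<in> K)"
    (is "?L \<longleftrightarrow> ?R")
proof -
  define R where "R = (ring_of_type_algebra :: 'b ring)"
  interpret R: field R unfolding R_def by rule
  have [simp]: "carrier R = UNIV" "\<one>\<^bsub>R\<^esub> = 1" "\<zero>\<^bsub>R\<^esub> = 0" "x \<otimes>\<^bsub>R\<^esub> y = x * y" "x \<oplus>\<^bsub>R\<^esub> y = x + y" for x y
    by (auto simp: R_def ring_of_type_algebra_def)
  have [simp]: "\<ominus>\<^bsub>R\<^esub> x = - x" for x
    by (rule R.minus_equality) auto
  have inv: "inv\<^bsub>R\<^esub> x = inverse x" if "x \<noteq> 0" for x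
    by (rule R.comm_inv_char) (use that in auto)
  have "?R" if L: "subfield K R"
  proof -
    have K: "subring K R" using L by (rule subfieldE)
    have "inverse x \<in> K" if "x \<in> K" for x
      using R.subfield_m_inv(1)[OF L, of x] subringE(2)[OF K] that inv by (cases "x = 0") auto
    moreover have "x - y \<in> K" if "x \<in> K" "y \<in> K" for x y
      using subringE(7)[OF K, of x "- y"] subringE(5)[OF K, of y] that by simp
    ultimately show ?thesis using subringE[OF K] by auto
  qed
  moreover have "subfield K R" if ?R
  proof (rule R.subfieldI')
    have 0: "0 \<in> K" using that by force
    have minus: "- x \<in> K" if "x \<in> K" for x
      using \<open>?R\<close> 0 that by (metis diff_0)
    have "x + y \<in> K" if "x \<in> K" "y \<in> K" for x y
      using \<open>?R\<close> minus[of y] that by (metis diff_minus_eq_add)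
    thus "subring K R"
      using that minus by (intro R.subringI) auto
    show "inv\<^bsub>R\<^esub> k \<in> K" if "k \<in> K - {\<zero>\<^bsub>R\<^esub>}" for k
      using \<open>?R\<close> that inv by auto
  qed
  ultimately show ?thesis unfolding R_def by blast
qed

lemma subfield_range_to_ac: "subfield (range to_ac) (ring_of_type_algebra :: 'a::field alg_closure ring)"
  unfolding subfield_iff
proof (intro conjI ballI)
  show "1 \<in> range (to_ac :: 'a \<Rightarrow> _)" by (metis rangeI to_ac_1)
  fix x y :: "'a alg_closure" assume x: "x \<in> range to_ac"
  show "inverse x \<in> range to_ac" using x by (auto simp flip: to_ac_inverse)
  assume y: "y \<in> range to_ac"
  show "x - y \<in> range to_ac" using x y by (auto simp flip: to_ac_diff)
  show "x * y \<in> range to_ac" using x y by (auto simp flip: to_ac_mult)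
qed

lemma eval_ring_of_type_algebra:
  "ring.eval (ring_of_type_algebra :: 'b::field ring) xs x = poly (Poly (rev xs)) x"
proof -
  define R where "R = (ring_of_type_algebra :: 'b ring)"
  interpret R: field R unfolding R_def by rule
  have [simp]: "carrier R = UNIV" "\<one>\<^bsub>R\<^esub> = 1" "\<zero>\<^bsub>R\<^esub> = 0" "x \<otimes>\<^bsub>R\<^esub> y = x * y" "x \<oplus>\<^bsub>R\<^esub> y = x + y" for x y
    by (auto simp: R_def ring_of_type_algebra_def)
  have [simp]: "x [^]\<^bsub>R\<^esub> (n::nat) = x ^ n" for n
    by (induction n) auto
  have "R.eval xs x = poly (Poly (rev xs)) x"
    by (induction xs) (auto simp: Poly_append poly_monom algebra_simps)
  thus ?thesis by (simp add: R_def)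
qed

lemma algebraic_over_type:
  fixes K :: "'b::field set"
  assumes "p \<noteq> 0" "set (coeffs p) \<subseteq> K" "poly p x = 0"
  shows "(ring.algebraic ring_of_type_algebra over K) x"
proof -
  define R where "R = (ring_of_type_algebra :: 'b ring)"
  interpret R: field R unfolding R_def by rule
  have "(R.algebraic over K) x"
  proof (rule R.algebraicI)
    show "rev (coeffs p) \<in> carrier (K[X]\<^bsub>R\<^esub>)"
      using assms by (auto simp: univ_poly_def polynomial_def hd_rev last_coeffs_eq_coeff_degree
        R_def ring_of_type_algebra_def)
    show "rev (coeffs p) \<noteq> []" using assms by simp
    show "R.eval (rev (coeffs p)) x = \<zero>\<^bsub>R\<^esub>"
      using assms by (simp add: R_def eval_ring_of_type_algebra) (simp add: ring_of_type_algebra_def)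
  qed
  thus ?thesis by (simp add: R_def)
qed

abbreviation adjoin :: "'b::field set \<Rightarrow> 'b \<Rightarrow> 'b set" where
  "adjoin K x \<equiv> ring.simple_extension ring_of_type_algebra K x"

lemma adjoin_subfield:
  fixes K :: "'b::field set"
  assumes K: "subfield K ring_of_type_algebra" and p: "p \<noteq> 0" "set (coeffs p) \<subseteq> K" "poly p x = 0"
  shows "subfield (adjoin K x) ring_of_type_algebra" "K \<subseteq> adjoin K x" "x \<in> adjoin K x"
    "ring.finite_dimension ring_of_type_algebra K (adjoin K x)"
proof -
  define R where "R = (ring_of_type_algebra :: 'b ring)"
  interpret R: field R unfolding R_def by rule
  have [simp]: "carrier R = UNIV" by (simp add: R_def ring_of_type_algebra_def)
  have alg: "(R.algebraic over K) x" unfolding R_def by (rule algebraic_over_type[OF p])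
  have K: "subfield K R" using K by (simp add: R_def)
  have "subfield (R.simple_extension K x) R" "K \<subseteq> R.simple_extension K x" "x \<in> R.simple_extension K x"
    "R.finite_dimension K (R.simple_extension K x)"
    using R.simple_extension_is_subfield[OF K, of x] R.simple_extension_incl[of K x]
      R.simple_extension_mem[OF subfieldE(1)[OF K], of x] R.finite_dimension_simple_extension[OF K, of x] alg
    by auto
  thus "subfield (adjoin K x) ring_of_type_algebra" "K \<subseteq> adjoin K x" "x \<in> adjoin K x"
    "ring.finite_dimension ring_of_type_algebra K (adjoin K x)"
    by (simp_all add: R_def)
qed

lemma adjoin_induct [consumes 1, case_names zero lin]:
  fixes K :: "'b::field set"
  assumes "y \<in> adjoin K x" "P 0" "\<And>k1 k2. P k1 \<Longrightarrow> k2 \<in> K \<Longrightarrow> P (k1 * x + k2)"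
  shows "P y"
proof -
  define R where "R = (ring_of_type_algebra :: 'b ring)"
  interpret R: field R unfolding R_def by rule
  have [simp]: "\<zero>\<^bsub>R\<^esub> = 0" "x \<otimes>\<^bsub>R\<^esub> y = x * y" "x \<oplus>\<^bsub>R\<^esub> y = x + y" for x y
    by (auto simp: R_def ring_of_type_algebra_def)
  from assms(1) have "y \<in> R.simple_extension K x" by (simp add: R_def)
  thus ?thesis by induction (use assms in auto)
qed

lemma finite_extension_adjoin:
  assumes K: "finite_extension K" and p: "p \<noteq> 0" "set (coeffs p) \<subseteq> K" "poly p x = 0"
  shows "finite_extension (adjoin K x)"
proof -
  define R where "R = (ring_of_type_algebra :: 'a alg_closure ring)"
  interpret R: field R unfolding R_def by rule
  from K have K': "subfield K R" "range to_ac \<subseteq> K" "R.finite_dimension (range to_ac) K"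
    by (auto simp: finite_extension_def R_def)
  have "R.finite_dimension (range to_ac) (adjoin K x)"
    using R.telescopic_base_dim(1)[of "range to_ac" K] K' adjoin_subfield(4)[OF _ p] subfield_range_to_ac
    by (simp add: R_def)
  thus ?thesis
    using K' adjoin_subfield(1,2)[OF _ p] by (auto simp: finite_extension_def R_def)
qed

lemma finite_extension_simple:
  fixes x :: "'a::field alg_closure"
  shows "finite_extension (adjoin (range to_ac) x)"
proof -
  obtain f :: "'a poly" where f: "f \<noteq> 0" "poly (map_poly to_ac f) x = 0"
    using alg_closure_algebraic[of x] by blast
  let ?f = "map_poly to_ac f"
  have "?f \<noteq> 0" using f(1) by (simp add: map_poly_eq_0_iff)
  moreover have "set (coeffs ?f) \<subseteq> range to_ac"
    by (auto simp: coeffs_def coeff_map_poly)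
  ultimately show ?thesis
    using adjoin_subfield[OF subfield_range_to_ac _ _ f(2)] by (auto simp: finite_extension_def)
qed

lemma mem_adjoin_range_to_ac: "x \<in> adjoin (range to_ac) (x :: 'a::field alg_closure)"
proof -
  define R where "R = (ring_of_type_algebra :: 'a alg_closure ring)"
  interpret R: field R unfolding R_def by rule
  show ?thesis
    using R.simple_extension_mem[of "range to_ac" x] subfieldE(1)[OF subfield_range_to_ac]
    by (simp add: R_def) (simp add: ring_of_type_algebra_def)
qed

lemma adjoin_range_to_ac:
  fixes x :: "'a::field alg_closure"
  assumes "y \<in> adjoin (range to_ac) x"
  shows "\<exists>h. y = ac_poly h x"
  using assms
proof (induction rule: adjoin_induct)
  case zero thus ?case by (intro exI[of _ 0]) simp
next
  case (lin y k)
  then obtain h c where "y = ac_poly h x" "k = to_ac c" by auto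
  thus ?case by (intro exI[of _ "h * [:0, 1:] + [:c:]"]) (simp only: ac_poly_add ac_poly_mult ac_poly_linear ac_poly_const, simp)
qed

lemma rat_subgroup_mod_double:
  fixes G :: "rat set"
  assumes G: "0 \<in> G" "\<And>x y. x \<in> G \<Longrightarrow> y \<in> G \<Longrightarrow> x - y \<in> G" and "a \<in> G" "b \<in> G"
  shows "\<exists>c\<in>G. a = c + c \<or> b = c + c \<or> a + b = c + c"
proof -
  have minus: "- x \<in> G" if "x \<in> G" for x using G(2)[OF G(1) that] by simp
  have plus: "x + y \<in> G" if "x \<in> G" "y \<in> G" for x y using G(2)[OF that(1) minus[OF that(2)]] by simp
  have nat: "of_nat n * x \<in> G" if "x \<in> G" for n x
    by (induction n) (auto simp: G algebra_simps that intro: plus)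
  have int: "of_int n * x \<in> G" if "x \<in> G" for n x
    using nat[OF that] minus[OF nat[OF that]] by (cases n rule: int_cases2) auto
  obtain m1 n1 m2 n2 :: int where mn: "a = of_int m1 / of_int n1" "n1 > 0" "b = of_int m2 / of_int n2" "n2 > 0"
    by (metis quotient_of_div quotient_of_denom_pos surj_pair)
  define N where "N = n1 * n2"
  define m where "m = m1 * n2"
  define n where "n = m2 * n1"
  have ab: "a = of_int m / of_int N" "b = of_int n / of_int N" "N > 0"
    using mn by (auto simp: N_def m_def n_def field_simps)
  obtain x y where xy: "x * m + y * n = gcd m n" using bezout_int[of m n] by auto
  define c where "c = of_int x * a + of_int y * b"
  have c: "c = of_int (gcd m n) / of_int N"
    unfolding c_def ab(1,2) xy[symmetric] by (simp add: add_divide_distrib)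
  have cG: "c \<in> G" unfolding c_def by (intro plus int assms)
  obtain m' n' where m'n': "m = gcd m n * m'" "n = gcd m n * n'" by (metis dvdE gcd_dvd1 gcd_dvd2)
  have a: "a = of_int m' * c" and b: "b = of_int n' * c"
    unfolding ab(1,2) c using m'n' by (metis (no_types, opaque_lifting) mult.commute of_int_mult times_divide_eq_left)+
  have *: "\<exists>d\<in>G. of_int k * c = d + d" if k: "even k" for k
  proof -
    obtain j where "k = 2 * j" using k by (rule evenE)
    thus ?thesis using int[OF cG, of j] by (intro bexI[of _ "of_int j * c"]) (auto simp: algebra_simps)
  qed
  have ab': "a + b = of_int (m' + n') * c" using a b by (simp add: algebra_simps)
  consider "even m'" | "even n'" | "even (m' + n')" by auto
  thus ?thesis
    by cases (use * a b ab' in metis)+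
qed

locale henselian_field = residue_map v for v :: "'a::field \<Rightarrow> int" +
  assumes henselian: "henselian v"
    and separably_closed: "separably_closed \<kappa>"
    and two: "(2::'a) \<noteq> 0" "v 2 = 0"
begin

lemma extended_valuation_iff:
  fixes K :: "'a alg_closure set"
  assumes "finite_extension K"
  shows "extended_valuation v K u \<longleftrightarrow> extends_to v K u"
proof
  assume "extended_valuation v K u"
  then interpret extended_valuation v K u .
  show "extends_to v K u" using L.valuation extends by (simp add: extends_to_def)
next
  assume u: "extends_to v K u"
  have K: "subfield K ring_of_type_algebra" "range to_ac \<subseteq> K" using assms by (auto simp: finite_extension_def)
  have "valued_field K u"
    using u K(1) unfolding extends_to_def subfield_iff by unfold_locales auto
  moreover have "extended_valuation_axioms v K u"
    using u K(2) by unfold_locales (auto simp: extends_to_def)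
  ultimately show "extended_valuation v K u"
    by (simp add: extended_valuation_def residue_map_axioms)
qed

lemma unit_square:
  assumes K: "finite_extension K" and u: "extended_valuation v K u"
    and a: "a \<in> K" "a \<noteq> 0" "u a = 0"
  shows "\<exists>b\<in>K. a = b\<^sup>2"
proof (rule ccontr)
  assume nsq: "\<not> (\<exists>b\<in>K. a = b\<^sup>2)"
  interpret ext: extended_valuation v K u by (rule u)
  obtain b where b: "b \<in> K" "ext.L.val_gt 0 (b\<^sup>2 - a)"
    using ext.residue_sqrt[OF separably_closed two a] by auto
  obtain s where s: "s\<^sup>2 = a" using nth_root_exists[of 2 a] by auto
  have sK: "s \<notin> K" using nsq s by auto
  define p where "p = [:- a, 0, 1:]"
  have p: "p \<noteq> 0" "set (coeffs p) \<subseteq> K" "poly p s = 0"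
    using a s by (auto simp: p_def ext.L.closed power2_eq_square)
  define M where "M = adjoin K s"
  have K': "subfield K ring_of_type_algebra" using K by (simp add: finite_extension_def)
  have M: "finite_extension M" unfolding M_def by (rule finite_extension_adjoin[OF K p])
  have KM: "K \<subseteq> M" "s \<in> M" unfolding M_def using adjoin_subfield[OF K' p] by auto
  have rep: "\<exists>c d. c \<in> K \<and> d \<in> K \<and> y = c + d * s" if "y \<in> M" for y
    using that unfolding M_def
  proof (induction rule: adjoin_induct)
    case zero thus ?case using ext.L.zero_closed by (intro exI[of _ 0]) auto
  next
    case (lin y k)
    then obtain c d where "c \<in> K" "d \<in> K" "y = c + d * s" by auto
    thus ?case using lin a s
      by (intro exI[of _ "k + d * a"] exI[of _ c]) (auto simp: ext.L.closed algebra_simps power2_eq_square)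
  qed
  from henselian M obtain w where w: "extends_to v M w"
    and uniq: "\<And>w' x. extends_to v M w' \<Longrightarrow> x \<in> M \<Longrightarrow> x \<noteq> 0 \<Longrightarrow> w' x = w x"
    unfolding henselian_def by (metis Diff_iff singletonD)
  interpret M: extended_valuation v M w using w extended_valuation_iff[OF M] by simp
  have wK: "w x = u x" if "x \<in> K" "x \<noteq> 0" for x
  proof -
    have "extends_to v K w"
      using w KM(1) unfolding extends_to_def valuation_on_def by (meson Diff_mono order_refl subsetD)
    moreover have "extends_to v K u" using u extended_valuation_iff[OF K] by simp
    ultimately show ?thesis
      using henselian K that unfolding henselian_def by (metis Diff_iff singletonD)
  qed
  \<comment> \<open>Conjugation over \<open>K\<close> preserves the extension, by uniqueness.\<close>
  define \<sigma> where "\<sigma> y = (THE z. \<exists>c d. c \<in> K \<and> d \<in> K \<and> y = c + d * s \<and> z = c - d * s)" for y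
  have unique: "c = c' \<and> d = d'" if "c \<in> K" "d \<in> K" "c' \<in> K" "d' \<in> K" "c + d * s = c' + d' * s" for c d c' d'
  proof -
    have e: "(d - d') * s = c' - c" using that(5) by (simp add: algebra_simps)
    have "d = d'"
    proof (rule ccontr)
      assume "d \<noteq> d'"
      hence "s = (c' - c) / (d - d')" using e by (simp add: field_simps)
      thus False using that sK by (auto simp: ext.L.closed)
    qed
    thus ?thesis using that(5) by simp
  qed
  have sig: "\<sigma> (c + d * s) = c - d * s" if "c \<in> K" "d \<in> K" for c d
    unfolding \<sigma>_def
  proof (rule the_equality)
    show "\<exists>c' d'. c' \<in> K \<and> d' \<in> K \<and> c + d * s = c' + d' * s \<and> c - d * s = c' - d' * s"
      using that by blast
    show "z = c - d * s" if "\<exists>c' d'. c' \<in> K \<and> d' \<in> K \<and> c + d * s = c' + d' * s \<and> z = c' - d' * s" for z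
      using that unique \<open>c \<in> K\<close> \<open>d \<in> K\<close> by blast
  qed
  have sig_closed: "\<sigma> y \<in> M" if y: "y \<in> M" for y
  proof -
    obtain c d where cd: "c \<in> K" "d \<in> K" "y = c + d * s" using rep[OF y] by blast
    thus ?thesis using sig[OF cd(1,2)] KM by (auto intro!: M.L.diff_closed M.L.mult_closed)
  qed
  have sig_add: "\<sigma> (y + z) = \<sigma> y + \<sigma> z" if yz: "y \<in> M" "z \<in> M" for y z
  proof -
    obtain c d c' d' where cd: "c \<in> K" "d \<in> K" "y = c + d * s" "c' \<in> K" "d' \<in> K" "z = c' + d' * s"
      using rep yz by metis
    have "y + z = (c + c') + (d + d') * s" using cd by (simp add: algebra_simps)
    moreover have "\<sigma> \<dots> = (c + c') - (d + d') * s" using cd by (intro sig) (auto simp: ext.L.closed)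
    moreover have "\<dots> = (c - d * s) + (c' - d' * s)" by (simp add: algebra_simps)
    ultimately show ?thesis using cd(3,6) sig[OF cd(1,2)] sig[OF cd(4,5)] by metis
  qed
  have sig_mult: "\<sigma> (y * z) = \<sigma> y * \<sigma> z" if yz: "y \<in> M" "z \<in> M" for y z
  proof -
    obtain c d c' d' where cd: "c \<in> K" "d \<in> K" "y = c + d * s" "c' \<in> K" "d' \<in> K" "z = c' + d' * s"
      using rep yz by metis
    have "y * z = (c * c' + d * d' * a) + (c * d' + d * c') * s"
      using cd s by (simp add: algebra_simps power2_eq_square)
    moreover have "\<sigma> \<dots> = (c * c' + d * d' * a) - (c * d' + d * c') * s"
      using cd a by (intro sig) (auto simp: ext.L.closed)
    moreover have "\<dots> = (c - d * s) * (c' - d' * s)" using s by (simp add: algebra_simps power2_eq_square)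
    ultimately show ?thesis using cd(3,6) sig[OF cd(1,2)] sig[OF cd(4,5)] by metis
  qed
  have sig_K: "\<sigma> c = c" if "c \<in> K" for c
    using sig[OF that ext.L.zero_closed] by simp
  have sig_nz: "\<sigma> y \<noteq> 0" if "y \<in> M" "y \<noteq> 0" for y
    using sig_mult[of y "inverse y"] sig_K[OF ext.L.one_closed] that M.L.inverse_closed by force
  have "extends_to v M (\<lambda>y. w (\<sigma> y))"
    unfolding extends_to_def valuation_on_def
  proof (intro conjI ballI impI allI)
    fix y z assume yz: "y \<in> M - {0}" "z \<in> M - {0}"
    show "w (\<sigma> (y * z)) = w (\<sigma> y) + w (\<sigma> z)"
      using yz sig_mult sig_closed sig_nz by (auto intro!: M.L.val_mult)
    assume "y + z \<noteq> 0"
    thus "min (w (\<sigma> y)) (w (\<sigma> z)) \<le> w (\<sigma> (y + z))"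
      using yz sig_add[of y z] sig_closed sig_nz sig_nz[of "y + z"] M.L.val_add[of "\<sigma> y" "\<sigma> z"] M.L.add_closed
      by auto
  next
    fix c :: 'a assume "c \<noteq> 0"
    thus "w (\<sigma> (to_ac c)) = of_int (v c)"
      using sig_K[OF ext.to_ac_closed] M.extends by simp
  qed
  hence conj: "w (\<sigma> y) = w y" if "y \<in> M" "y \<noteq> 0" for y using uniq that by blast
  have bM: "b + s \<in> M" "b - s \<in> M" using b KM by (auto simp: M.L.closed)
  have nz: "b + s \<noteq> 0" "b - s \<noteq> 0"
  proof -
    show "b - s \<noteq> 0" using sK b(1) by auto
    show "b + s \<noteq> 0"
    proof
      assume "b + s = 0"
      hence "s = - b" by (simp add: eq_neg_iff_add_eq_0 add.commute)
      thus False using sK ext.L.uminus_closed[OF b(1)] by simp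
    qed
  qed
  have "\<sigma> (b + s) = b - s" using sig[OF b(1) ext.L.one_closed] by simp
  with conj[OF bM(1) nz(1)] have eq: "w (b - s) = w (b + s)" by simp
  have prod: "(b + s) * (b - s) = b\<^sup>2 - a" using s by (simp add: algebra_simps power2_eq_square)
  have "b\<^sup>2 - a \<noteq> 0" using nz prod by auto
  hence "w (b\<^sup>2 - a) > 0" using b wK a by (auto simp: ext.L.val_gt_def ext.L.closed)
  hence pos: "w (b + s) > 0" using M.L.val_mult[OF bM nz] eq by (simp add: prod)
  have "M.L.val_gt 0 ((b + s) - (b - s))"
    using pos eq by (intro M.L.val_gt_diff[OF bM]) (auto simp: M.L.val_gt_def)
  moreover have "(b + s) - (b - s) = to_ac 2 * s"
    unfolding to_ac_numeral mult_2 by (simp only: diff_diff_eq2 add_diff_cancel_left' add.assoc)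
  ultimately have gt: "M.L.val_gt 0 (to_ac 2 * s)" by metis
  have s0: "s \<noteq> 0" using s a by auto
  have "w (s * s) = 0" using wK[OF a(1,2)] a(3) s unfolding power2_eq_square by simp
  hence "w s = 0" using s0 KM by (simp add: M.L.val_mult)
  have "to_ac (2::'a) \<noteq> 0" using two(1) by (simp only: to_ac_eq_0_iff not_False_eq_True)
  hence nz2: "to_ac 2 * s \<noteq> 0" "w (to_ac 2 * s) = w (to_ac 2) + w s"
    using s0 KM(2) M.to_ac_closed by (simp_all only: M.L.val_mult mult_eq_0_iff simp_thms)
  have "w (to_ac 2) = 0" using M.extends[OF two(1)] two(2) by (simp only: of_int_0)
  with nz2(2) \<open>w s = 0\<close> have "w (to_ac 2 * s) = 0" by (simp only: add_0_left)
  with gt nz2(1) show False by (simp only: M.L.val_gt_def) simp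
qed

theorem three_elements_square_ratio:
  fixes K :: "'a alg_closure set"
  assumes K: "finite_extension K" and abc: "a \<in> K" "b \<in> K" "c \<in> K" "a \<noteq> 0" "b \<noteq> 0" "c \<noteq> 0"
  shows "\<exists>y\<in>K. a = b * y\<^sup>2 \<or> b = c * y\<^sup>2 \<or> a = c * y\<^sup>2"
proof -
  from henselian K obtain u where "extends_to v K u" unfolding henselian_def by blast
  hence u: "extended_valuation v K u" using extended_valuation_iff[OF K] by simp
  interpret ext: extended_valuation v K u by (rule u)
  define G where "G = u ` (K - {0})"
  have G0: "0 \<in> G" unfolding G_def using ext.L.val_one ext.L.one_closed by (force simp: image_iff)
  have Gd: "x - y \<in> G" if "x \<in> G" "y \<in> G" for x y
  proof -
    from that obtain g h where "g \<in> K" "g \<noteq> 0" "x = u g" "h \<in> K" "h \<noteq> 0" "y = u h" by (auto simp: G_def)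
    thus ?thesis unfolding G_def
      by (intro image_eqI[of _ _ "g / h"]) (auto simp: ext.L.val_divide ext.L.closed)
  qed
  have uG: "u x \<in> G" if "x \<in> K" "x \<noteq> 0" for x using that by (auto simp: G_def)
  have sq: "\<exists>y\<in>K. x = x' * y\<^sup>2" if x: "x \<in> K" "x \<noteq> 0" "x' \<in> K" "x' \<noteq> 0" "g \<in> G" "u x - u x' = g + g" for x x' g
  proof -
    from that(5) obtain z where z: "z \<in> K" "z \<noteq> 0" "g = u z" by (auto simp: G_def)
    have "u (x / (x' * (z * z))) = 0"
      using that z by (simp add: ext.L.val_divide ext.L.val_mult ext.L.closed)
    then obtain t where "t \<in> K" "x / (x' * (z * z)) = t\<^sup>2"
      using unit_square[OF K u, of "x / (x' * (z * z))"] x z by (auto simp: ext.L.closed)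
    thus ?thesis using that z
      by (intro bexI[of _ "z * t"]) (auto simp: field_simps power2_eq_square ext.L.closed)
  qed
  obtain g where "g \<in> G" "u a - u b = g + g \<or> u b - u c = g + g \<or> (u a - u b) + (u b - u c) = g + g"
    using rat_subgroup_mod_double[OF G0 Gd Gd Gd, OF _ _ uG uG uG uG, of a b b c] abc by blast
  thus ?thesis using sq[of a b g] sq[of b c g] sq[of a c g] abc by auto
qed

end

section \<open>Quadratic forms over the completion\<close>

locale completed_field = valued_field UNIV w for w :: "'b::field \<Rightarrow> int"
begin

abbreviation CR where "CR \<equiv> Cauchy_ring w"
abbreviation NI where "NI \<equiv> {s. val_null w s}"
abbreviation cls where "cls \<equiv> (+>\<^bsub>CR\<^esub>) NI"

lemma val_null_iff: "val_null w s \<longleftrightarrow> (\<forall>n. \<exists>N. \<forall>i\<ge>N. val_ge n (s i))"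
  by (simp add: val_null_def val_ge_def)

lemma val_Cauchy_iff: "val_Cauchy w s \<longleftrightarrow> (\<forall>n. \<exists>N. \<forall>i\<ge>N. \<forall>j\<ge>N. val_ge n (s i - s j))"
  by (simp add: val_Cauchy_def val_ge_def)

lemma val_ge_mono: "m \<le> n \<Longrightarrow> val_ge n x \<Longrightarrow> val_ge m x"
  by (auto simp: val_ge_def)

lemma val_null_imp_Cauchy: "val_null w s \<Longrightarrow> val_Cauchy w s"
  unfolding val_null_iff val_Cauchy_iff by (meson UNIV_I val_ge_diff)

lemma val_Cauchy_const: "val_Cauchy w (\<lambda>_. x)"
  by (simp add: val_Cauchy_iff)

lemma val_null_zero: "val_null w (\<lambda>_. 0)"
  by (simp add: val_null_iff)

lemma val_null_add:
  assumes "val_null w s" "val_null w t" shows "val_null w (\<lambda>i. s i + t i)"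
  unfolding val_null_iff
proof
  fix n
  from assms obtain N M where "\<forall>i\<ge>N. val_ge n (s i)" "\<forall>i\<ge>M. val_ge n (t i)"
    unfolding val_null_iff by blast
  thus "\<exists>N. \<forall>i\<ge>N. val_ge n (s i + t i)"
    by (intro exI[of _ "max N M"]) (auto intro: val_ge_add)
qed

lemma val_null_uminus: "val_null w s \<Longrightarrow> val_null w (\<lambda>i. - s i)"
  by (simp add: val_null_iff val_ge_uminus)

lemma val_Cauchy_add:
  assumes "val_Cauchy w s" "val_Cauchy w t" shows "val_Cauchy w (\<lambda>i. s i + t i)"
  unfolding val_Cauchy_iff
proof
  fix n
  from assms obtain N M where "\<forall>i\<ge>N. \<forall>j\<ge>N. val_ge n (s i - s j)" "\<forall>i\<ge>M. \<forall>j\<ge>M. val_ge n (t i - t j)"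
    unfolding val_Cauchy_iff by blast
  thus "\<exists>N. \<forall>i\<ge>N. \<forall>j\<ge>N. val_ge n (s i + t i - (s j + t j))"
    by (intro exI[of _ "max N M"]) (auto simp: add_diff_add intro: val_ge_add)
qed

lemma val_Cauchy_uminus: "val_Cauchy w s \<Longrightarrow> val_Cauchy w (\<lambda>i. - s i)"
  unfolding val_Cauchy_iff by simp blast

lemma val_Cauchy_bounded:
  assumes "val_Cauchy w s" shows "\<exists>B N. \<forall>i\<ge>N. val_ge B (s i)"
proof -
  from assms obtain N where N: "\<forall>i\<ge>N. \<forall>j\<ge>N. val_ge 0 (s i - s j)"
    unfolding val_Cauchy_iff by blast
  have "val_ge (min 0 (w (s N))) (s i)" if "i \<ge> N" for i
  proof -
    have "val_ge (min 0 (w (s N))) (s i - s N)" using N that by (intro val_ge_mono[OF _ N[rule_format]]) auto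
    moreover have "val_ge (min 0 (w (s N))) (s N)" by (simp add: val_ge_def)
    ultimately have "val_ge (min 0 (w (s N))) (s i - s N + s N)" by (intro val_ge_add) auto
    thus ?thesis by simp
  qed
  thus ?thesis by blast
qed

lemma val_null_mult:
  assumes "val_Cauchy w s" "val_null w t" shows "val_null w (\<lambda>i. s i * t i)"
  unfolding val_null_iff
proof
  fix n
  from val_Cauchy_bounded[OF assms(1)] obtain B N where "\<forall>i\<ge>N. val_ge B (s i)" by blast
  moreover from assms(2) obtain M where "\<forall>i\<ge>M. val_ge (n - B) (t i)" unfolding val_null_iff by blast
  ultimately show "\<exists>N. \<forall>i\<ge>N. val_ge n (s i * t i)"
    using val_ge_mult[of _ _ B "n - B"] by (intro exI[of _ "max N M"]) auto
qed

lemma val_Cauchy_mult: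
  assumes "val_Cauchy w s" "val_Cauchy w t" shows "val_Cauchy w (\<lambda>i. s i * t i)"
  unfolding val_Cauchy_iff
proof
  fix n
  from val_Cauchy_bounded[OF assms(1)] obtain B N where B: "\<forall>i\<ge>N. val_ge B (s i)" by blast
  from val_Cauchy_bounded[OF assms(2)] obtain B' N' where B': "\<forall>i\<ge>N'. val_ge B' (t i)" by blast
  from assms obtain M M' where M: "\<forall>i\<ge>M. \<forall>j\<ge>M. val_ge (n - B') (s i - s j)"
    and M': "\<forall>i\<ge>M'. \<forall>j\<ge>M'. val_ge (n - B) (t i - t j)"
    unfolding val_Cauchy_iff by blast
  show "\<exists>N. \<forall>i\<ge>N. \<forall>j\<ge>N. val_ge n (s i * t i - s j * t j)"
  proof (intro exI allI impI)
    fix i j assume ij: "i \<ge> max (max N N') (max M M')" "j \<ge> max (max N N') (max M M')"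
    have "val_ge n (s i * (t i - t j))"
      using val_ge_mult[of "s i" "t i - t j" B "n - B"] B M' ij by auto
    moreover have "val_ge n (t j * (s i - s j))"
      using val_ge_mult[of "t j" "s i - s j" B' "n - B'"] B' M ij by auto
    ultimately have "val_ge n (s i * (t i - t j) + t j * (s i - s j))" by (intro val_ge_add) auto
    thus "val_ge n (s i * t i - s j * t j)" by (simp add: algebra_simps)
  qed
qed

lemma Cauchy_ring_simps [simp]:
  "s \<in> carrier CR \<longleftrightarrow> val_Cauchy w s" "s \<otimes>\<^bsub>CR\<^esub> t = (\<lambda>i. s i * t i)" "s \<oplus>\<^bsub>CR\<^esub> t = (\<lambda>i. s i + t i)"
  "\<zero>\<^bsub>CR\<^esub> = (\<lambda>i. 0)" "\<one>\<^bsub>CR\<^esub> = (\<lambda>i. 1)"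
  by (simp_all add: Cauchy_ring_def)

lemma cring_CR: "cring CR"
proof (rule cringI)
  show "abelian_group CR"
  proof (rule abelian_groupI)
    fix s assume "s \<in> carrier CR"
    thus "\<exists>t\<in>carrier CR. t \<oplus>\<^bsub>CR\<^esub> s = \<zero>\<^bsub>CR\<^esub>"
      by (intro bexI[of _ "\<lambda>i. - s i"]) (auto simp: val_Cauchy_uminus)
  qed (auto intro: val_Cauchy_add val_Cauchy_const simp: algebra_simps)
  show "comm_monoid CR"
    by unfold_locales (auto simp: val_Cauchy_const mult_ac intro: val_Cauchy_mult)
qed (auto simp: algebra_simps)

lemma ideal_NI: "ideal NI CR"
proof -
  interpret cring CR by (rule cring_CR)
  have minus: "\<ominus>\<^bsub>CR\<^esub> s = (\<lambda>i. - s i)" if "val_Cauchy w s" for s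
    by (rule minus_equality) (use that in \<open>auto simp: val_Cauchy_uminus\<close>)
  show ?thesis
  proof (rule idealI)
    show "subgroup NI (add_monoid CR)"
    proof (rule add.subgroupI)
      show "NI \<noteq> {}" using val_null_zero by blast
      show "\<ominus>\<^bsub>CR\<^esub> s \<in> NI" if "s \<in> NI" for s
        using that by (simp add: minus val_null_imp_Cauchy val_null_uminus)
    qed (auto intro: val_null_imp_Cauchy val_null_add)
    show "a \<otimes>\<^bsub>CR\<^esub> x \<in> NI" if "a \<in> NI" "x \<in> carrier CR" for a x
      using val_null_mult[of x a] that by (simp add: mult.commute)
  qed (auto intro: val_null_mult ring_axioms)
qed

sublocale NI: ideal NI CR by (rule ideal_NI)

sublocale cls: ring_hom_cring CR "completion w" cls
  unfolding completion_def by (rule NI.rcos_ring_hom_cring[OF cring_CR])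

lemma cls_eq_zero_iff: "val_Cauchy w s \<Longrightarrow> cls s = \<zero>\<^bsub>completion w\<^esub> \<longleftrightarrow> val_null w s"
  using NI.a_rcos_zero[OF ideal_NI] NI.a_rcos_self[of s]
  by (auto simp: completion_def FactRing_def)

lemma cls_surj: "z \<in> carrier (completion w) \<Longrightarrow> \<exists>s. val_Cauchy w s \<and> z = cls s"
  by (auto simp: completion_def FactRing_def A_RCOSETS_def')

lemma finsum_CR:
  "finite A \<Longrightarrow> (\<And>i. i \<in> A \<Longrightarrow> val_Cauchy w (f i)) \<Longrightarrow> finsum CR f A = (\<lambda>n. \<Sum>i\<in>A. f i n)"
  by (induction A rule: finite_induct) (auto simp: NI.finsum_insert)

lemma val_Cauchy_sum:
  "(\<And>i. i \<in> A \<Longrightarrow> val_Cauchy w (f i)) \<Longrightarrow> val_Cauchy w (\<lambda>n. \<Sum>i\<in>A. f i n)"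
  by (induction A rule: infinite_finite_induct) (auto simp: val_Cauchy_const val_Cauchy_add)

lemma diag_form_completion:
  assumes "length ss = length as" "\<forall>s\<in>set ss. val_Cauchy w s"
  shows "diag_form (completion w) (map (to_completion w) as) (map cls ss) =
    cls (\<lambda>n. \<Sum>i<length as. as ! i * ((ss ! i) n)\<^sup>2)"
proof -
  define F where "F i = (\<lambda>n. as ! i * ((ss ! i) n)\<^sup>2)" for i
  have F: "val_Cauchy w (F i)" if "i < length as" for i
    unfolding F_def power2_eq_square using that assms
    by (intro val_Cauchy_mult val_Cauchy_const) auto
  have "map (to_completion w) as ! i \<otimes>\<^bsub>completion w\<^esub> (map cls ss ! i [^]\<^bsub>completion w\<^esub> (2::nat)) = cls (F i)"
    if i: "i < length as" for i
  proof -
    have s: "val_Cauchy w (ss ! i)" using assms i by auto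
    have "cls (ss ! i) [^]\<^bsub>completion w\<^esub> (2::nat) = cls (\<lambda>n. (ss ! i) n * (ss ! i) n)"
      using s cls.hom_closed[of "ss ! i"] cls.hom_mult[of "ss ! i" "ss ! i"] by (simp add: numeral_2_eq_2)
    thus ?thesis
      using i assms cls.hom_mult[of "\<lambda>_. as ! i" "\<lambda>n. (ss ! i) n * (ss ! i) n"] s
      by (simp add: to_completion_def F_def power2_eq_square val_Cauchy_const val_Cauchy_mult)
  qed
  hence "diag_form (completion w) (map (to_completion w) as) (map cls ss) =
      finsum (completion w) (\<lambda>i. cls (F i)) {..<length as}"
    unfolding diag_form_def using F cls.hom_closed by (intro cls.S.finsum_cong') auto
  also have "\<dots> = cls (finsum CR F {..<length as})"
    using F by (subst cls.hom_finsum) (auto simp: o_def)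
  also have "finsum CR F {..<length as} = (\<lambda>n. \<Sum>i<length as. as ! i * ((ss ! i) n)\<^sup>2)"
    using F by (subst finsum_CR) (auto simp: F_def)
  finally show ?thesis .
qed

theorem isotropic_completion_iff:
  "isotropic (completion w) (map (to_completion w) as) \<longleftrightarrow>
    (\<exists>ss. length ss = length as \<and> (\<forall>s\<in>set ss. val_Cauchy w s) \<and> (\<exists>s\<in>set ss. \<not> val_null w s) \<and>
      val_null w (\<lambda>n. \<Sum>i<length as. as ! i * ((ss ! i) n)\<^sup>2))"
  (is "?L \<longleftrightarrow> (\<exists>ss. ?P ss)")
proof -
  have C: "val_Cauchy w (\<lambda>n. \<Sum>i<length as. as ! i * ((ss ! i) n)\<^sup>2)"
    if "length ss = length as" "\<forall>s\<in>set ss. val_Cauchy w s" for ss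
    unfolding power2_eq_square using that
    by (intro val_Cauchy_sum val_Cauchy_mult val_Cauchy_const) auto
  show ?thesis
  proof
    assume ?L
    then obtain ys where ys: "length ys = length as" "set ys \<subseteq> carrier (completion w)"
      "\<exists>y\<in>set ys. y \<noteq> \<zero>\<^bsub>completion w\<^esub>"
      "diag_form (completion w) (map (to_completion w) as) ys = \<zero>\<^bsub>completion w\<^esub>"
      by (auto simp: isotropic_def)
    define g where "g y = (SOME s. val_Cauchy w s \<and> y = cls s)" for y
    have g: "val_Cauchy w (g y)" "y = cls (g y)" if "y \<in> set ys" for y
      using someI_ex[OF cls_surj[of y]] ys(2) that by (auto simp: g_def)
    define ss where "ss = map g ys"
    have ss: "length ss = length as" "\<forall>s\<in>set ss. val_Cauchy w s" "map cls ss = ys"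
      using ys(1) g by (auto simp: ss_def intro!: map_idI)
    have "val_null w (\<lambda>n. \<Sum>i<length as. as ! i * ((ss ! i) n)\<^sup>2)"
      using ys(4) ss(3) cls_eq_zero_iff[OF C[OF ss(1,2)]] diag_form_completion[OF ss(1,2)] by metis
    moreover have "\<exists>s\<in>set ss. \<not> val_null w s"
    proof -
      from ys(3) obtain y where y: "y \<in> set ys" "y \<noteq> \<zero>\<^bsub>completion w\<^esub>" by blast
      hence "g y \<in> set ss" "\<not> val_null w (g y)"
        using g[of y] cls_eq_zero_iff[of "g y"] by (auto simp: ss_def)
      thus ?thesis by blast
    qed
    ultimately have "?P ss" using ss(1,2) by blast
    thus "\<exists>ss. ?P ss" ..
  next
    assume "\<exists>ss. ?P ss"
    then obtain ss where "?P ss" ..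
    hence ss: "length ss = length as" "\<forall>s\<in>set ss. val_Cauchy w s" "\<exists>s\<in>set ss. \<not> val_null w s"
      "val_null w (\<lambda>n. \<Sum>i<length as. as ! i * ((ss ! i) n)\<^sup>2)" by blast+
    have "diag_form (completion w) (map (to_completion w) as) (map cls ss) = \<zero>\<^bsub>completion w\<^esub>"
      unfolding diag_form_completion[OF ss(1,2)] cls_eq_zero_iff[OF C[OF ss(1,2)]] by (rule ss(4))
    moreover have "set (map cls ss) \<subseteq> carrier (completion w)" using ss by (auto intro!: cls.hom_closed)
    moreover have "\<exists>y\<in>set (map cls ss). y \<noteq> \<zero>\<^bsub>completion w\<^esub>"
      using ss(2,3) cls_eq_zero_iff by auto
    ultimately show ?L unfolding isotropic_def using ss by (intro exI[of _ "map cls ss"]) simp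
  qed
qed

lemma val_pow2: "x \<noteq> 0 \<Longrightarrow> w (x\<^sup>2) = 2 * w x"
  by (simp add: power2_eq_square val_mult)

lemma newton_sqrt:
  assumes two: "(2::'b) \<noteq> 0" "w 2 = 0" and z: "z \<noteq> 0" and y: "val_gt (w z) (y\<^sup>2 - z)"
  shows "\<exists>s. val_Cauchy w s \<and> val_null w (\<lambda>n. (s n)\<^sup>2 - z)"
proof -
  define s where "s = rec_nat y (\<lambda>_ t. (t + z / t) / 2)"
  have s0: "s 0 = y" and sS: "s (Suc n) = (s n + z / s n) / 2" for n
    by (simp_all add: s_def)
  have four: "(4::'b) \<noteq> 0" using two(1) by (metis mult_eq_0_iff num_double numeral_times_numeral)
  have sz: "t \<noteq> 0 \<and> 2 * w t = w z" if "val_gt (w z) (t\<^sup>2 - z)" for t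
    using val_add_gt[of z "t\<^sup>2 - z"] z that by (auto simp: val_pow2)
  have inv: "val_ge (w z + int n + 1) ((s n)\<^sup>2 - z)" for n
  proof (induction n)
    case 0 thus ?case using y by (auto simp: s0 val_ge_def val_gt_def)
  next
    case (Suc n)
    define t where "t = s n"
    have t: "t \<noteq> 0" "2 * w t = w z" using sz[of t] Suc by (auto simp: t_def val_ge_def val_gt_def)
    have eq: "(s (Suc n))\<^sup>2 - z = (t\<^sup>2 - z)\<^sup>2 / (2 * t)\<^sup>2"
      unfolding sS t_def[symmetric] using t two four by (simp add: field_simps power2_eq_square)
    show ?case
    proof (cases "t\<^sup>2 - z = 0")
      case True thus ?thesis by (simp add: eq)
    next
      case False
      have "w ((t\<^sup>2 - z)\<^sup>2 / (2 * t)\<^sup>2) = 2 * w (t\<^sup>2 - z) - w z"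
      proof -
        have "2 * t \<noteq> 0" using t two by simp
        hence "w ((t\<^sup>2 - z)\<^sup>2 / (2 * t)\<^sup>2) = w ((t\<^sup>2 - z)\<^sup>2) - w ((2 * t)\<^sup>2)"
          using False by (intro val_divide power_not_zero) auto
        also have "\<dots> = 2 * w (t\<^sup>2 - z) - 2 * w (2 * t)"
          using False \<open>2 * t \<noteq> 0\<close> by (simp only: val_pow2 simp_thms)
        also have "w (2 * t) = w t" using val_mult[of 2 t] t two by simp
        finally show ?thesis using t by simp
      qed
      moreover have "w (t\<^sup>2 - z) \<ge> w z + int n + 1" using Suc False by (simp add: val_ge_def t_def)
      ultimately show ?thesis unfolding eq val_ge_def by simp
    qed
  qed
  have gt: "val_gt (w z) ((s n)\<^sup>2 - z)" for n
    using inv[of n] by (auto simp: val_ge_def val_gt_def)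
  have step: "val_ge (w y + int n + 1) (s (Suc n) - s n)" for n
  proof -
    have t: "s n \<noteq> 0" "2 * w (s n) = w z" "w y = w (s n)"
      using sz[OF gt[of n]] sz[OF y] by auto
    have eq: "s (Suc n) - s n = - (((s n)\<^sup>2 - z) / (2 * s n))"
      unfolding sS using t two by (simp add: field_simps power2_eq_square)
    show ?thesis unfolding eq
      using inv[of n] t two
      by (cases "(s n)\<^sup>2 - z = 0") (auto simp: val_ge_def val_uminus val_divide val_mult)
  qed
  have diff: "val_ge (w y + int n + 1) (s (n + k) - s n)" for n k
  proof (induction k)
    case (Suc k)
    have "val_ge (w y + int n + 1) (s (Suc (n + k)) - s (n + k))"
      using step[of "n + k"] by (rule val_ge_mono[rotated]) simp
    hence "val_ge (w y + int n + 1) ((s (Suc (n + k)) - s (n + k)) + (s (n + k) - s n))"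
      using Suc by (simp only: val_ge_add UNIV_I)
    thus ?case by simp
  qed simp
  have "val_Cauchy w s"
    unfolding val_Cauchy_iff
  proof
    fix m
    define N where "N = nat (m - w y)"
    have "val_ge m (s i - s j)" if "i \<ge> N" "j \<ge> N" for i j
    proof -
      have *: "val_ge m (s i - s N)" if "i \<ge> N" for i
        using diff[of N "i - N"] that val_ge_mono[of m "w y + int N + 1" "s i - s N"] by (simp add: N_def)
      have "val_ge m ((s i - s N) - (s j - s N))" using *[of i] *[of j] that by (simp only: val_ge_diff UNIV_I)
      thus ?thesis by simp
    qed
    thus "\<exists>N. \<forall>i\<ge>N. \<forall>j\<ge>N. val_ge m (s i - s j)" by blast
  qed
  moreover have "val_null w (\<lambda>n. (s n)\<^sup>2 - z)"
    unfolding val_null_iff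
  proof
    fix m
    have "val_ge m ((s i)\<^sup>2 - z)" if "i \<ge> nat (m - w z)" for i
      using inv[of i] by (rule val_ge_mono[rotated]) (use that in simp)
    thus "\<exists>N. \<forall>i\<ge>N. val_ge m ((s i)\<^sup>2 - z)" by blast
  qed
  ultimately show ?thesis by blast
qed

theorem isotropic_completionI:
  assumes two: "(2::'b) \<noteq> 0" "w 2 = 0"
    and ij: "i < length as" "j < length as" "i \<noteq> j" "as ! i \<noteq> 0" "as ! j \<noteq> 0"
    and y: "val_gt (w (as ! j)) (as ! j + as ! i * y\<^sup>2)"
  shows "isotropic (completion w) (map (to_completion w) as)"
proof -
  define a where "a = as ! i"
  define b where "b = as ! j"
  define z where "z = - b / a"
  have ab: "a \<noteq> 0" "b \<noteq> 0" using ij by (auto simp: a_def b_def)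
  have z: "z \<noteq> 0" "w z = w b - w a"
    using ab by (auto simp: z_def val_uminus val_divide)
  have "y\<^sup>2 - z = (b + a * y\<^sup>2) / a" using ab by (simp add: z_def field_simps)
  hence "val_gt (w z) (y\<^sup>2 - z)"
    using y ab z by (cases "b + a * y\<^sup>2 = 0") (auto simp: val_gt_def val_divide a_def[symmetric] b_def[symmetric])
  from newton_sqrt[OF two z(1) this] obtain s where s: "val_Cauchy w s" "val_null w (\<lambda>n. (s n)\<^sup>2 - z)"
    by blast
  define ss where "ss = ((replicate (length as) (\<lambda>_. 0))[i := s])[j := (\<lambda>_. 1::'b)]"
  have nth: "ss ! k = (if k = j then (\<lambda>_. 1) else if k = i then s else (\<lambda>_. 0))" if "k < length as" for k
    using that ij by (auto simp: ss_def nth_list_update)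
  have len: "length ss = length as" by (simp add: ss_def)
  have "val_Cauchy w t" if "t \<in> set ss" for t
    using that s nth len by (auto simp: in_set_conv_nth val_Cauchy_const)
  moreover have "\<exists>t\<in>set ss. \<not> val_null w t"
  proof
    show "(\<lambda>_. 1) \<in> set ss" using nth[of j] ij len by (metis nth_mem)
    show "\<not> val_null w (\<lambda>_. 1)"
      unfolding val_null_iff by (auto simp: val_ge_def val_one intro!: exI[of _ "1::int"])
  qed
  moreover have "(\<Sum>k<length as. as ! k * ((ss ! k) n)\<^sup>2) = a * ((s n)\<^sup>2 - z)" for n
  proof -
    have "(\<Sum>k<length as. as ! k * ((ss ! k) n)\<^sup>2) = (\<Sum>k\<in>{i, j}. as ! k * ((ss ! k) n)\<^sup>2)"
      using ij nth by (intro sum.mono_neutral_right) auto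
    also have "\<dots> = a * (s n)\<^sup>2 + b" using ij nth by (simp add: a_def b_def)
    also have "\<dots> = a * ((s n)\<^sup>2 - z)" using ab by (simp add: z_def field_simps)
    finally show ?thesis .
  qed
  moreover have "val_null w (\<lambda>n. a * ((s n)\<^sup>2 - z))"
    using val_null_mult[OF val_Cauchy_const s(2)] .
  ultimately show ?thesis
    unfolding isotropic_completion_iff using len by (intro exI[of _ ss]) auto
qed

end

section \<open>Gauss valuations\<close>

locale gauss = valued_field UNIV u for u :: "'a::field \<Rightarrow> int"
begin

text \<open>The minimum of \<open>u c\<^sub>i + i\<close> over the coefficients \<open>c\<^sub>i\<close> is \<open>\<mu>\<close>, last attained at \<open>i = d\<close>.\<close>

definition gauss_lead :: "'a poly \<Rightarrow> int \<Rightarrow> nat \<Rightarrow> bool" where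
  "gauss_lead f \<mu> d \<longleftrightarrow> coeff f d \<noteq> 0 \<and> u (coeff f d) = \<mu> - int d \<and>
    (\<forall>i. val_ge (\<mu> - int i) (coeff f i)) \<and> (\<forall>i>d. val_gt (\<mu> - int i) (coeff f i))"

lemma gauss_lead_nonzero: "gauss_lead f \<mu> d \<Longrightarrow> f \<noteq> 0"
  by (auto simp: gauss_lead_def)

lemma gauss_lead_exists:
  assumes "f \<noteq> 0" shows "\<exists>\<mu> d. gauss_lead f \<mu> d"
proof -
  define S where "S = {i. coeff f i \<noteq> 0}"
  have S: "finite S" "S \<noteq> {}"
    using MOST_coeff_eq_0[of f] leading_coeff_0_iff[of f] assms
    by (auto simp: S_def eventually_cofinite simp del: leading_coeff_0_iff)
  define wt where "wt i = u (coeff f i) + int i" for i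
  define \<mu> where "\<mu> = Min (wt ` S)"
  define T where "T = {i\<in>S. wt i = \<mu>}"
  have "\<mu> \<in> wt ` S" unfolding \<mu>_def using S by (intro Min_in) auto
  hence T: "finite T" "T \<noteq> {}" using S by (auto simp: T_def)
  define d where "d = Max T"
  have d: "d \<in> T" unfolding d_def using T by (rule Max_in)
  have le: "\<mu> \<le> wt i" if "i \<in> S" for i unfolding \<mu>_def using S that by (intro Min_le) auto
  have lt: "\<mu> < wt i" if "i \<in> S" "i > d" for i
  proof -
    have "i \<notin> T" using that(2) Max_ge[OF T(1), of i] by (auto simp: d_def)
    thus ?thesis using le[OF that(1)] that(1) by (auto simp: T_def)
  qed
  have "gauss_lead f \<mu> d"
    unfolding gauss_lead_def
  proof (intro conjI allI impI)
    show "coeff f d \<noteq> 0" "u (coeff f d) = \<mu> - int d" using d by (auto simp: T_def S_def wt_def)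
    show "val_ge (\<mu> - int i) (coeff f i)" for i
      using le[of i] by (cases "i \<in> S") (auto simp: S_def wt_def val_ge_def)
    show "val_gt (\<mu> - int i) (coeff f i)" if "i > d" for i
      using lt[of i] that by (cases "i \<in> S") (auto simp: S_def wt_def val_gt_def)
  qed
  thus ?thesis by blast
qed

lemma gauss_lead_le:
  assumes "gauss_lead f \<mu> d" "\<forall>i. val_ge (\<nu> - int i) (coeff f i)" shows "\<nu> \<le> \<mu>"
  using assms(1) assms(2)[rule_format, of d] by (auto simp: gauss_lead_def val_ge_def)

lemma gauss_lead_unique:
  assumes "gauss_lead f \<mu> d" "gauss_lead f \<nu> e" shows "\<mu> = \<nu>"
  using gauss_lead_le[OF assms(1), of \<nu>] gauss_lead_le[OF assms(2), of \<mu>] assms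
  by (auto simp: gauss_lead_def)

lemma gauss_lead_add:
  assumes f: "gauss_lead f \<mu> d" and g: "gauss_lead g \<nu> e" and lt: "\<mu> < \<nu> \<or> \<mu> = \<nu> \<and> e < d"
  shows "gauss_lead (f + g) \<mu> d"
proof -
  have ge: "val_ge (\<mu> - int i) (coeff g i)" for i
    using g lt by (auto simp: gauss_lead_def val_ge_def dest!: spec[of _ i])
  have gt: "val_gt (\<mu> - int i) (coeff g i)" if "i \<ge> d" for i
    using g lt that by (auto simp: gauss_lead_def val_ge_def val_gt_def dest!: spec[of _ i])
  have "val_gt (u (coeff f d)) (coeff g d)" using gt[of d] f by (simp add: gauss_lead_def)
  note lead = val_add_gt[OF _ _ _ this]
  show ?thesis unfolding gauss_lead_def
  proof (intro conjI allI impI)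
    show "coeff (f + g) d \<noteq> 0" "u (coeff (f + g) d) = \<mu> - int d" 
      using f lead by (auto simp: gauss_lead_def)
    show "val_ge (\<mu> - int i) (coeff (f + g) i)" for i
      unfolding coeff_add using f ge[of i] by (intro val_ge_add) (auto simp: gauss_lead_def)
    show "val_gt (\<mu> - int i) (coeff (f + g) i)" if "i > d" for i
      unfolding coeff_add using f gt[of i] that by (intro val_gt_add) (auto simp: gauss_lead_def)
  qed
qed

lemma gauss_lead_mult:
  assumes f: "gauss_lead f \<mu> d" and g: "gauss_lead g \<nu> e"
  shows "gauss_lead (f * g) (\<mu> + \<nu>) (d + e)"
proof -
  have ge: "val_ge (\<mu> + \<nu> - int i) (coeff f k * coeff g (i - k))" if "k \<le> i" for k i
  proof -
    have "val_ge ((\<mu> - int k) + (\<nu> - int (i - k))) (coeff f k * coeff g (i - k))"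
      using f g by (intro val_ge_mult) (auto simp: gauss_lead_def)
    moreover have "(\<mu> - int k) + (\<nu> - int (i - k)) = \<mu> + \<nu> - int i" using that by (simp add: of_nat_diff)
    ultimately show ?thesis by (simp only:)
  qed
  have gt: "val_gt (\<mu> + \<nu> - int i) (coeff f k * coeff g (i - k))"
    if "k \<le> i" "k > d \<or> i - k > e" for k i
  proof -
    have eq: "(\<mu> - int k) + (\<nu> - int (i - k)) = \<mu> + \<nu> - int i" using that by (simp add: of_nat_diff)
    from that(2) have "val_gt ((\<mu> - int k) + (\<nu> - int (i - k))) (coeff f k * coeff g (i - k))"
    proof
      assume "i - k > e"
      thus ?thesis using f g by (intro val_gt_mult) (auto simp: gauss_lead_def)
    next
      assume "k > d"
      hence "val_gt ((\<nu> - int (i - k)) + (\<mu> - int k)) (coeff g (i - k) * coeff f k)" 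
        using f g by (intro val_gt_mult) (auto simp: gauss_lead_def)
      thus ?thesis by (simp only: mult.commute[of "coeff f k"] add.commute[of "\<mu> - int k"])
    qed
    thus ?thesis by (simp only: eq)
  qed
  have f0: "coeff f d \<noteq> 0" "u (coeff f d) = \<mu> - int d" and g0: "coeff g e \<noteq> 0" "u (coeff g e) = \<nu> - int e"
    using f g by (auto simp: gauss_lead_def)
  define R where "R = (\<Sum>k\<in>{..d + e} - {d}. coeff f k * coeff g (d + e - k))"
  have c: "coeff (f * g) (d + e) = coeff f d * coeff g e + R"
    unfolding coeff_mult R_def by (subst sum.remove[of _ d]) auto
  have R: "val_gt (\<mu> + \<nu> - int (d + e)) R"
    unfolding R_def
  proof (rule val_gt_sum)
    fix k assume "k \<in> {..d + e} - {d}"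
    thus "val_gt (\<mu> + \<nu> - int (d + e)) (coeff f k * coeff g (d + e - k))"
      by (intro gt) auto
  qed auto
  have u0: "u (coeff f d * coeff g e) = \<mu> + \<nu> - int (d + e)"
    using f0 g0 by (simp add: val_mult)
  show ?thesis
    unfolding gauss_lead_def
  proof (intro conjI allI impI)
    show "coeff (f * g) (d + e) \<noteq> 0" "u (coeff (f * g) (d + e)) = \<mu> + \<nu> - int (d + e)"
      using val_add_gt[of "coeff f d * coeff g e" R] f0 g0 R unfolding c u0 by simp_all
    show "val_ge (\<mu> + \<nu> - int i) (coeff (f * g) i)" for i
      unfolding coeff_mult by (intro val_ge_sum) (auto intro: ge)
    show "val_gt (\<mu> + \<nu> - int i) (coeff (f * g) i)" if "i > d + e" for i
      unfolding coeff_mult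
    proof (intro val_gt_sum)
      fix k assume "k \<in> {..i}"
      thus "val_gt (\<mu> + \<nu> - int i) (coeff f k * coeff g (i - k))" using that by (intro gt) auto
    qed auto
  qed
qed

lemma gauss_lead_sum:
  assumes "finite I" "I \<noteq> {}" "\<And>i. i \<in> I \<Longrightarrow> gauss_lead (f i) (\<alpha> i) (\<delta> i)"
    and "\<And>i j. i \<in> I \<Longrightarrow> j \<in> I \<Longrightarrow> i \<noteq> j \<Longrightarrow> (\<alpha> i, \<delta> i) \<noteq> (\<alpha> j, \<delta> j)"
  shows "\<exists>j\<in>I. gauss_lead (\<Sum>i\<in>I. f i) (\<alpha> j) (\<delta> j) \<and> (\<forall>i\<in>I. \<alpha> j \<le> \<alpha> i)"
  using assms
proof (induction I rule: finite_ne_induct)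
  case (insert x I)
  then obtain j where j: "j \<in> I" "gauss_lead (\<Sum>i\<in>I. f i) (\<alpha> j) (\<delta> j)" "\<forall>i\<in>I. \<alpha> j \<le> \<alpha> i"
    by auto
  have x: "gauss_lead (f x) (\<alpha> x) (\<delta> x)" using insert by simp
  have "(\<alpha> x, \<delta> x) \<noteq> (\<alpha> j, \<delta> j)" using insert j by (metis insertCI)
  then consider "\<alpha> x < \<alpha> j \<or> \<alpha> x = \<alpha> j \<and> \<delta> j < \<delta> x" | "\<alpha> j < \<alpha> x \<or> \<alpha> j = \<alpha> x \<and> \<delta> x < \<delta> j"
    by (metis linorder_neqE prod.inject)
  thus ?case
  proof cases
    case 1
    with gauss_lead_add[OF x j(2)] j(3) insert.hyps show ?thesis by fastforce
  next
    case 2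
    with gauss_lead_add[OF j(2) x] j insert.hyps show ?thesis by (fastforce simp: add.commute)
  qed
qed auto

definition gval :: "'a poly \<Rightarrow> int" where
  "gval f = (THE \<mu>. \<exists>d. gauss_lead f \<mu> d)"

lemma gval_eq: "gauss_lead f \<mu> d \<Longrightarrow> gval f = \<mu>"
  unfolding gval_def using gauss_lead_unique by blast

lemma gval_mult: "f \<noteq> 0 \<Longrightarrow> g \<noteq> 0 \<Longrightarrow> gval (f * g) = gval f + gval g"
  by (metis gauss_lead_exists gauss_lead_mult gval_eq)

lemma gval_add:
  assumes "f \<noteq> 0" "g \<noteq> 0" "f + g \<noteq> 0"
  shows "min (gval f) (gval g) \<le> gval (f + g)"
proof -
  obtain \<mu> d \<nu> e \<rho> k where *: "gauss_lead f \<mu> d" "gauss_lead g \<nu> e" "gauss_lead (f + g) \<rho> k"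
    using assms gauss_lead_exists by metis
  have "val_ge (min \<mu> \<nu> - int i) (coeff (f + g) i)" for i
    unfolding coeff_add using *(1,2)
    by (intro val_ge_add) (auto simp: gauss_lead_def val_ge_def dest!: spec[of _ i])
  hence "min \<mu> \<nu> \<le> \<rho>" using gauss_lead_le[OF *(3)] by blast
  thus ?thesis using * by (simp add: gval_eq)
qed

definition gauss_val :: "'a poly fract \<Rightarrow> int" where
  "gauss_val q = (THE n. \<exists>a b. a \<noteq> 0 \<and> b \<noteq> 0 \<and> q = Fract a b \<and> n = gval a - gval b)"

lemma gauss_val_Fract:
  assumes "a \<noteq> 0" "b \<noteq> 0"
  shows "gauss_val (Fract a b) = gval a - gval b"
  unfolding gauss_val_def
proof (rule the_equality)
  fix n assume "\<exists>a' b'. a' \<noteq> 0 \<and> b' \<noteq> 0 \<and> Fract a b = Fract a' b' \<and> n = gval a' - gval b'"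
  then obtain c d where cd: "c \<noteq> 0" "d \<noteq> 0" "Fract a b = Fract c d" "n = gval c - gval d" by blast
  hence "a * d = c * b" using assms by (simp add: eq_fract)
  hence "gval a + gval d = gval c + gval b" using assms cd gval_mult by metis
  thus "n = gval a - gval b" using cd by simp
qed (use assms in blast)

lemma gauss_val_valuation: "valuation_on UNIV gauss_val"
  unfolding valuation_on_def
proof (intro conjI ballI impI)
  fix x y :: "'a poly fract" assume xy: "x \<in> UNIV - {0}" "y \<in> UNIV - {0}"
  obtain a b where ab: "x = Fract a b" "b \<noteq> 0" by (cases x) auto
  obtain c d where cd: "y = Fract c d" "d \<noteq> 0" by (cases y) auto
  have nz: "a \<noteq> 0" "c \<noteq> 0" using xy ab cd by (auto simp: Zero_fract_def eq_fract)
  show "gauss_val (x * y) = gauss_val x + gauss_val y"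
    using nz ab cd by (simp add: gauss_val_Fract gval_mult)
  assume ne: "x + y \<noteq> 0"
  have sum: "x + y = Fract (a * d + c * b) (b * d)" using ab cd by simp
  have n0: "a * d + c * b \<noteq> 0" using ne ab cd by (auto simp: sum Zero_fract_def eq_fract)
  have "min (gval (a * d)) (gval (c * b)) \<le> gval (a * d + c * b)"
    using nz ab cd n0 by (intro gval_add) auto
  moreover have "gauss_val (x + y) = gval (a * d + c * b) - gval (b * d)"
    unfolding sum using ab cd n0 by (intro gauss_val_Fract) auto
  ultimately show "min (gauss_val x) (gauss_val y) \<le> gauss_val (x + y)"
    using nz ab cd by (simp add: gauss_val_Fract gval_mult)
qed

lemma gauss_lead_monom: "c \<noteq> 0 \<Longrightarrow> gauss_lead (monom c d) (u c + int d) d"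
  by (auto simp: gauss_lead_def val_ge_def val_gt_def)

lemma gauss_val_to_fract: "gauss_lead f \<mu> d \<Longrightarrow> gauss_val (to_fract f) = \<mu>"
  using gauss_lead_monom[of 1 0] gauss_lead_nonzero[of f] 
  by (simp add: to_fract_def gauss_val_Fract gval_eq monom_0 one_pCons val_one)

sublocale W: completed_field gauss_val
  using gauss_val_valuation by unfold_locales auto

end

lemma common_denominator:
  fixes y :: "'i \<Rightarrow> 'a::idom fract"
  assumes "finite I"
  shows "\<exists>q p. q \<noteq> 0 \<and> (\<forall>i\<in>I. y i * to_fract q = to_fract (p i))"
  using assms
proof (induction I rule: finite_induct)
  case empty show ?case by (intro exI[of _ 1]) auto
next
  case (insert x I)
  then obtain q p where qp: "q \<noteq> 0" "\<forall>i\<in>I. y i * to_fract q = to_fract (p i)" by blast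
  obtain a b where ab: "y x = Fract a b" "b \<noteq> 0" by (cases "y x") auto
  have "y x * to_fract (b * q) = to_fract (a * q)" using ab by (simp add: to_fract_def eq_fract)
  moreover have "y i * to_fract (b * q) = to_fract (p i * b)" if "i \<in> I" for i
    using qp(2) that by (simp add: to_fract_mult mult_ac)
  ultimately show ?case
    using ab qp(1) insert.hyps
    by (intro exI[of _ "b * q"] exI[of _ "\<lambda>i. if i = x then a * q else p i * b"]) auto
qed

context gauss
begin

theorem anisotropic_completion:
  fixes A :: "'a poly list"
  assumes lead: "\<And>i. i < length A \<Longrightarrow> gauss_lead (A ! i) (\<alpha> i) (\<delta> i)"
    and distinct: "\<And>i j f g \<mu> d \<nu> e. i < length A \<Longrightarrow> j < length A \<Longrightarrow> i \<noteq> j \<Longrightarrow>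
      gauss_lead f \<mu> d \<Longrightarrow> gauss_lead g \<nu> e \<Longrightarrow> (\<alpha> i + 2 * \<mu>, \<delta> i + 2 * d) \<noteq> (\<alpha> j + 2 * \<nu>, \<delta> j + 2 * e)"
  shows "anisotropic (completion gauss_val) (map (to_completion gauss_val) (map to_fract A))"
proof
  assume "isotropic (completion gauss_val) (map (to_completion gauss_val) (map to_fract A))"
  then obtain ss where ss: "length ss = length A" "\<exists>s\<in>set ss. \<not> val_null gauss_val s"
    "val_null gauss_val (\<lambda>n. \<Sum>i<length A. map to_fract A ! i * ((ss ! i) n)\<^sup>2)"
    unfolding W.isotropic_completion_iff by auto
  have key: "(\<Sum>i<length A. to_fract (A ! i) * (y i)\<^sup>2) \<noteq> 0 \<and>
      gauss_val (\<Sum>i<length A. to_fract (A ! i) * (y i)\<^sup>2) \<le> gauss_val (to_fract (A ! j)) + 2 * gauss_val (y j)"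
    if j: "j < length A" "y j \<noteq> 0" for y j
  proof -
    obtain q p where qp: "q \<noteq> 0" "\<And>i. i < length A \<Longrightarrow> y i * to_fract q = to_fract (p i)"
      using common_denominator[of "{..<length A}" y] by auto
    define I where "I = {i. i < length A \<and> p i \<noteq> 0}"
    have jI: "j \<in> I"
    proof -
      have "to_fract (p j) \<noteq> 0" using qp(1) qp(2)[OF j(1), symmetric] j(2) by simp
      thus ?thesis using j by (auto simp: I_def)
    qed
    define L where "L i = (SOME (\<mu>d :: int \<times> nat). gauss_lead (p i) (fst \<mu>d) (snd \<mu>d))" for i
    have L: "gauss_lead (p i) (fst (L i)) (snd (L i))" if "i \<in> I" for i
    proof -
      have "\<exists>\<mu>d. gauss_lead (p i) (fst \<mu>d) (snd \<mu>d)"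
        using gauss_lead_exists[of "p i"] that by (auto simp: I_def)
      thus ?thesis unfolding L_def by (rule someI_ex)
    qed
    define S where "S = (\<Sum>i\<in>I. A ! i * (p i * p i))"
    have "\<exists>k\<in>I. gauss_lead S (\<alpha> k + 2 * fst (L k)) (\<delta> k + 2 * snd (L k)) \<and>
        (\<forall>i\<in>I. \<alpha> k + 2 * fst (L k) \<le> \<alpha> i + 2 * fst (L i))"
      unfolding S_def
    proof (rule gauss_lead_sum)
      show "finite I" "I \<noteq> {}" using jI by (auto simp: I_def)
      show "gauss_lead (A ! i * (p i * p i)) (\<alpha> i + 2 * fst (L i)) (\<delta> i + 2 * snd (L i))" if "i \<in> I" for i
        using gauss_lead_mult[OF lead gauss_lead_mult[OF L[OF that] L[OF that]], of i] that
        by (simp only: I_def mem_Collect_eq mult_2)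
      show "(\<alpha> i + 2 * fst (L i), \<delta> i + 2 * snd (L i)) \<noteq> (\<alpha> k + 2 * fst (L k), \<delta> k + 2 * snd (L k))"
        if "i \<in> I" "k \<in> I" "i \<noteq> k" for i k
        using distinct[of i k, OF _ _ that(3) L[OF that(1)] L[OF that(2)]] that by (simp add: I_def)
    qed
    then obtain k where k: "gauss_lead S (\<alpha> k + 2 * fst (L k)) (\<delta> k + 2 * snd (L k))"
      "\<forall>i\<in>I. \<alpha> k + 2 * fst (L k) \<le> \<alpha> i + 2 * fst (L i)" by blast
    have SA: "S = (\<Sum>i<length A. A ! i * (p i * p i))"
      unfolding S_def by (intro sum.mono_neutral_left) (auto simp: I_def)
    define Y where "Y = (\<Sum>i<length A. to_fract (A ! i) * (y i)\<^sup>2)"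
    have "Y * (to_fract q)\<^sup>2 = (\<Sum>i<length A. to_fract (A ! i) * (y i * to_fract q)\<^sup>2)"
      by (simp add: Y_def sum_distrib_right power_mult_distrib mult.assoc)
    also have "\<dots> = to_fract S"
      using qp(2) by (simp add: SA power2_eq_square to_fract_sum to_fract_mult)
    finally have Y: "Y * (to_fract q)\<^sup>2 = to_fract S" .
    have q0: "to_fract q \<noteq> 0" using qp(1) by simp
    have S0: "to_fract S \<noteq> 0" using gauss_lead_nonzero[OF k(1)] by simp
    have Y0: "Y \<noteq> 0" using Y S0 by auto
    have "gauss_val Y + 2 * gauss_val (to_fract q) = gauss_val (to_fract S)"
      unfolding Y[symmetric] using Y0 q0 by (simp add: W.val_mult W.val_pow2)
    also have "\<dots> \<le> \<alpha> j + 2 * fst (L j)" using gauss_val_to_fract[OF k(1)] k(2) jI by auto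
    also have "fst (L j) = gauss_val (y j) + gauss_val (to_fract q)"
      using gauss_val_to_fract[OF L[OF jI]] qp(2)[OF j(1), symmetric] j(2) q0
      by (simp add: W.val_mult)
    also have "\<alpha> j = gauss_val (to_fract (A ! j))" using gauss_val_to_fract[OF lead[OF j(1)]] by simp
    finally show ?thesis using Y0 unfolding Y_def by simp
  qed
  from ss(1,2) obtain j where j: "j < length A" "\<not> val_null gauss_val (ss ! j)" by (metis in_set_conv_nth)
  then obtain n where n: "\<And>N. \<exists>i\<ge>N. \<not> W.val_ge n ((ss ! j) i)" unfolding W.val_null_iff by blast
  from ss(3) obtain N where N: "\<And>i. i \<ge> N \<Longrightarrow>
      W.val_ge (gauss_val (to_fract (A ! j)) + 2 * n) (\<Sum>k<length A. map to_fract A ! k * ((ss ! k) i)\<^sup>2)"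
    unfolding W.val_null_iff by blast
  from n[of N] obtain i where i: "i \<ge> N" "\<not> W.val_ge n ((ss ! j) i)" by blast
  have eq: "(\<Sum>k<length A. map to_fract A ! k * ((ss ! k) i)\<^sup>2) = (\<Sum>k<length A. to_fract (A ! k) * ((ss ! k) i)\<^sup>2)"
    by (intro sum.cong) auto
  show False
    using key[of j "\<lambda>k. (ss ! k) i"] j(1) N[OF i(1)] i(2) unfolding eq by (auto simp: W.val_ge_def)
qed

end

section \<open>The forms over the rational function field\<close>

lemma valuation_power:
  fixes w :: "'b::field \<Rightarrow> int"
  assumes "valued_field UNIV w" "x \<noteq> 0"
  shows "w (x ^ n) = int n * w x"
proof -
  interpret valued_field UNIV w by fact
  show ?thesis using assms(2) by (induction n) (auto simp: val_one val_mult algebra_simps)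
qed

lemma rf_const_simps:
  "rf_const (a + b) = rf_const a + rf_const b" "rf_const (a * b) = rf_const a * rf_const b"
  "rf_const (- a) = - rf_const a" "rf_const 1 = 1" "rf_const c = 0 \<longleftrightarrow> c = 0"
proof -
  show "rf_const (a + b) = rf_const a + rf_const b" "rf_const (a * b) = rf_const a * rf_const b"
    by (simp_all add: rf_const_def flip: to_fract_add to_fract_mult)
  show "rf_const (- a) = - rf_const a" by (simp add: rf_const_def flip: to_fract_uminus)
  show "rf_const 1 = 1" by (simp add: rf_const_def flip: one_pCons)
  show "rf_const c = 0 \<longleftrightarrow> c = 0" by (simp add: rf_const_def)
qed

lemma rf_X_nonzero: "rf_X \<noteq> 0"
  by (simp add: rf_X_def)

lemma to_fract_power: "to_fract (a ^ n) = to_fract a ^ n"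
  by (induction n) (auto simp: to_fract_mult)

definition phi_poly :: "'a::field \<Rightarrow> nat \<Rightarrow> 'a poly list" where
  "phi_poly p r = [monom 1 r - [:p:], monom 1 (r + 1) + [:p:], [:0, p:], monom 1 (r + 1) + [:0, p:]]"

lemma phi_eq_map: "phi p r = map to_fract (phi_poly p r)"
proof -
  have m: "to_fract (monom 1 n) = rf_X ^ n" for n
    by (simp add: rf_X_def monom_altdef flip: to_fract_power)
  have l: "to_fract [:0, p:] = rf_const p * rf_X"
    by (simp add: rf_X_def rf_const_def flip: to_fract_mult)
  show ?thesis
    by (simp add: phi_def phi_poly_def m l to_fract_diff to_fract_add flip: rf_const_def)
      (simp add: algebra_simps)
qed

lemma residue_point:
  fixes w :: "'a::field poly fract \<Rightarrow> int"
  assumes w: "Z_valuation w" and triv: "\<And>c. c \<noteq> 0 \<Longrightarrow> w (rf_const c) = 0" and X: "w rf_X \<ge> 0"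
  obtains x where "\<And>f. f \<noteq> 0 \<Longrightarrow> w (to_fract f) \<ge> 0"
    "\<And>f. f \<noteq> 0 \<Longrightarrow> w (to_fract f) > 0 \<longleftrightarrow> ac_poly f x = 0"
proof -
  interpret valued_field UNIV w using w by (rule Z_valuation_valued_field)
  have int: "val_ge 0 (to_fract f)" for f
  proof (induction f)
    case (pCons a f)
    have "to_fract (pCons a f) = rf_const a + rf_X * to_fract f"
      by (simp add: rf_const_def rf_X_def flip: to_fract_add to_fract_mult)
    moreover have "val_ge 0 (rf_const a)" using triv[of a] by (cases "a = 0") (auto simp: val_ge_def rf_const_simps)
    moreover have "val_ge 0 (rf_X * to_fract f)"
      using X pCons by (intro val_ge_mult_int) (auto simp: val_ge_def)
    ultimately show ?case using val_ge_add[of "rf_const a" "rf_X * to_fract f"] by simp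
  qed simp
  have nonneg: "w (to_fract f) \<ge> 0" if "f \<noteq> 0" for f using int[of f] that by (simp add: val_ge_def)
  define P where "P f \<longleftrightarrow> f \<noteq> 0 \<and> w (to_fract f) > 0" for f
  have "\<exists>f. P f"
  proof -
    have "1 \<in> w ` (UNIV - {0})" using w by (simp add: Z_valuation_def)
    then obtain q where q: "q \<noteq> 0" "w q = 1" by force
    obtain a b where ab: "q = Fract a b" "b \<noteq> 0" by (cases q) auto
    have a0: "a \<noteq> 0" using ab q by (auto simp: Zero_fract_def eq_fract)
    have "q = to_fract a / to_fract b" using ab by (simp add: to_fract_def)
    hence "w (to_fract a) - w (to_fract b) = 1" using q a0 ab by (simp add: val_divide)
    thus ?thesis using nonneg[of b] a0 ab by (auto simp: P_def)
  qed
  then obtain p where p: "P p" and pmin: "\<And>f. P f \<Longrightarrow> degree p \<le> degree f"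
    using exists_least_iff[of "\<lambda>n. \<exists>f. P f \<and> degree f = n"] by (metis not_le)
  have gt: "val_gt 0 (to_fract f)" if "P f \<or> f = 0" for f using that by (auto simp: P_def val_gt_def)
  have Pdvd: "p dvd f" if "P f" for f
  proof -
    have "to_fract (f mod p) = to_fract f - to_fract (f div p) * to_fract p"
      by (simp add: minus_div_mult_eq_mod flip: to_fract_diff to_fract_mult)
    moreover have "val_gt 0 (to_fract f - to_fract (f div p) * to_fract p)"
      using gt[of f] gt[of p] that p int by (intro val_gt_diff val_gt_mult_int(1)) auto
    ultimately have "val_gt 0 (to_fract (f mod p))" by simp
    hence "f mod p = 0 \<or> P (f mod p)" by (auto simp: val_gt_def P_def)
    moreover have "f mod p = 0 \<or> degree (f mod p) < degree p"
      using degree_mod_less[of p f] p by (auto simp: P_def)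
    ultimately have "f mod p = 0" using pmin[of "f mod p"] by auto
    thus ?thesis by (simp add: mod_eq_0_iff_dvd)
  qed
  have "degree p > 0"
  proof (rule ccontr)
    assume "\<not> degree p > 0"
    then obtain c where "p = [:c:]" by (auto elim: degree_eq_zeroE)
    thus False using p triv[of c] by (auto simp: P_def rf_const_def)
  qed
  hence "degree (map_poly to_ac p) > 0" by (simp add: degree_map_poly)
  then obtain x where x: "ac_poly p x = 0"
    using alg_closed_imp_poly_has_root[of "map_poly to_ac p"] unfolding ac_poly_def by blast
  define Q where "Q f \<longleftrightarrow> f \<noteq> 0 \<and> ac_poly f x = 0" for f
  have "Q p" using p x by (auto simp: Q_def P_def)
  then obtain m where m: "Q m" and mmin: "\<And>f. Q f \<Longrightarrow> degree m \<le> degree f"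
    using exists_least_iff[of "\<lambda>n. \<exists>f. Q f \<and> degree f = n"] by (metis not_le)
  have Qdvd: "m dvd f" if "ac_poly f x = 0" for f
  proof -
    have "ac_poly (f mod m) x = ac_poly f x - ac_poly (f div m) x * ac_poly m x"
      by (simp add: minus_div_mult_eq_mod flip: ac_poly_diff ac_poly_mult)
    hence "f mod m = 0 \<or> Q (f mod m)" using that m by (auto simp: Q_def)
    moreover have "f mod m = 0 \<or> degree (f mod m) < degree m"
      using degree_mod_less[of m f] m by (auto simp: Q_def)
    ultimately have "f mod m = 0" using mmin[of "f mod m"] by auto
    thus ?thesis by (simp add: mod_eq_0_iff_dvd)
  qed
  have m0: "m \<noteq> 0" "degree m > 0"
  proof -
    show "m \<noteq> 0" using m by (simp add: Q_def)
    show "degree m > 0"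
    proof (rule ccontr)
      assume "\<not> degree m > 0"
      then obtain c where "m = [:c:]" by (auto elim: degree_eq_zeroE)
      thus False using m by (auto simp: Q_def)
    qed
  qed
  have "P m"
  proof (rule ccontr)
    assume "\<not> P m"
    hence wm: "w (to_fract m) = 0" using nonneg[OF m0(1)] m0(1) by (auto simp: P_def)
    obtain n where n: "p = m * n" using Qdvd[OF x] by auto
    have n0: "n \<noteq> 0" using n p by (auto simp: P_def)
    have "w (to_fract p) = w (to_fract n)"
      unfolding n using m0 n0 wm by (simp add: to_fract_mult val_mult)
    hence "P n" using n0 p by (simp add: P_def)
    hence "degree p \<le> degree n" by (rule pmin)
    thus False using n m0 n0 by (simp add: degree_mult_eq)
  qed
  show ?thesis
  proof (rule that[of x])
    show "w (to_fract f) \<ge> 0" if "f \<noteq> 0" for f using nonneg[OF that] .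
    show "w (to_fract f) > 0 \<longleftrightarrow> ac_poly f x = 0" if f: "f \<noteq> 0" for f
    proof
      assume "w (to_fract f) > 0"
      hence "p dvd f" using Pdvd f by (simp add: P_def)
      thus "ac_poly f x = 0" using x by (auto simp: ac_poly_mult)
    next
      assume "ac_poly f x = 0"
      then obtain n where n: "f = m * n" using Qdvd by blast
      have "n \<noteq> 0" using f n by auto
      thus "w (to_fract f) > 0" unfolding n
        using \<open>P m\<close> nonneg[of n] m0 by (simp add: to_fract_mult val_mult P_def)
    qed
  qed
qed

context henselian_field
begin

lemma unit_is_square:
  assumes "c \<noteq> 0" "v c = 0"
  shows "\<exists>d. c = d\<^sup>2"
proof -
  define K where "K = adjoin (range to_ac) (0 :: 'a alg_closure)"
  have K: "finite_extension K" unfolding K_def by (rule finite_extension_simple)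
  from henselian K obtain u where "extends_to v K u" unfolding henselian_def by blast
  hence u: "extended_valuation v K u" using extended_valuation_iff[OF K] by simp
  interpret ext: extended_valuation v K u by (rule u)
  have "\<exists>b\<in>K. to_ac c = b\<^sup>2"
    using assms ext.extends[of c] by (intro unit_square[OF K u] ext.to_ac_closed) auto
  then obtain b where b: "b \<in> K" "to_ac c = b\<^sup>2" by blast
  obtain h where "b = ac_poly h 0" using adjoin_range_to_ac b(1) unfolding K_def by blast
  hence "b = to_ac (coeff h 0)" by (simp add: ac_poly_def poly_0_coeff_0 coeff_map_poly)
  hence "to_ac c = to_ac ((coeff h 0)\<^sup>2)" using b by simp
  thus ?thesis unfolding to_ac_eq_iff by blast
qed

text \<open>Units of \<open>v\<close> are \<open>2^n\<close>-th powers for all \<open>n\<close>, so every \<open>\<int>\<close>-valued valuation is trivial on them.\<close>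

lemma valuation_trivial_on_units:
  assumes w: "valued_field UNIV w" and c: "c \<noteq> 0" "v c = 0"
  shows "w c = (0::int)"
proof -
  interpret w: valued_field UNIV w by fact
  have dvd: "2 ^ n dvd w c" if "c \<noteq> 0" "v c = 0" for n c
    using that
  proof (induction n arbitrary: c)
    case (Suc n)
    obtain d where d: "c = d\<^sup>2" using unit_is_square Suc.prems by blast
    have d0: "d \<noteq> 0" using d Suc.prems by auto
    have "v d = 0" using d d0 Suc.prems by (simp add: power2_eq_square val_mult)
    hence "2 ^ n dvd w d" using Suc.IH d0 by blast
    thus ?case using d d0 by (simp add: power2_eq_square w.val_mult flip: mult_2)
  qed simp
  show ?thesis
  proof (rule ccontr)
    assume "w c \<noteq> 0"
    hence "\<bar>2 ^ nat \<bar>w c\<bar>\<bar> \<le> \<bar>w c\<bar>" using dvd_imp_le_int[OF _ dvd[OF c]] by blast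
    moreover have "int (nat \<bar>w c\<bar>) < 2 ^ nat \<bar>w c\<bar>" by (rule of_nat_less_two_power)
    ultimately show False by simp
  qed
qed

lemma valuation_eq_multiple:
  assumes w: "valued_field UNIV w" and p: "\<pi> \<noteq> 0" "v \<pi> = 1" and c: "c \<noteq> 0"
  shows "w c = v c * (w \<pi> :: int)"
proof -
  interpret w: valued_field UNIV w by fact
  have v: "valued_field UNIV v" by unfold_locales
  have nonneg: "w c = v c * w \<pi>" if c: "c \<noteq> 0" "v c \<ge> 0" for c
  proof -
    define n where "n = nat (v c)"
    have "v (c / \<pi> ^ n) = 0"
      using c p by (simp add: val_divide valuation_power[OF v] n_def)
    hence "w (c / \<pi> ^ n) = 0" using c p by (intro valuation_trivial_on_units[OF w]) auto
    thus ?thesis using c p by (simp add: w.val_divide valuation_power[OF w] n_def)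
  qed
  show ?thesis
  proof (cases "v c \<ge> 0")
    case True thus ?thesis using nonneg c by blast
  next
    case False
    thus ?thesis using nonneg[of "inverse c"] c by (simp add: val_inverse w.val_inverse)
  qed
qed

lemma valuation_uniformizer_nonneg:
  assumes w: "valued_field UNIV w" and p: "\<pi> \<noteq> 0" "v \<pi> = 1"
  shows "w \<pi> \<ge> (0::int)"
proof (rule ccontr)
  assume neg: "\<not> w \<pi> \<ge> 0"
  interpret w: valued_field UNIV w by fact
  have "1 + \<pi> \<noteq> 0" "v (1 + \<pi>) = 0"
    using val_add_gt[of 1 \<pi>] p by (auto simp: val_one val_gt_def)
  hence "w (1 + \<pi>) = 0" by (rule valuation_trivial_on_units[OF w])
  moreover have "w (\<pi> + 1) = w \<pi>"
    using p neg by (intro w.val_add_gt) (auto simp: w.val_gt_def w.val_one)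
  ultimately show False using neg by (simp add: add.commute)
qed

lemma Omega_restriction:
  assumes w: "w \<in> Omega m" and p: "\<pi> \<noteq> 0" "v \<pi> = 1"
  shows "0 \<le> w (rf_const \<pi>)" "w (rf_const \<pi>) \<le> int m"
    "\<And>c. c \<noteq> 0 \<Longrightarrow> w (rf_const c) = v c * w (rf_const \<pi>)"
proof -
  from w have Zw: "Z_valuation w" by (simp add: Omega_def)
  interpret w: valued_field UNIV w using Zw by (rule Z_valuation_valued_field)
  define w' where "w' c = w (rf_const c)" for c
  have w': "valued_field UNIV w'"
  proof unfold_locales
    have "min (w (rf_const x)) (w (rf_const y)) \<le> w (rf_const (x + y))"
      if "x \<noteq> 0" "y \<noteq> 0" "x + y \<noteq> 0" for x y
      unfolding rf_const_simps(1) using that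
      by (intro w.val_add) (auto simp: rf_const_simps(5) simp flip: rf_const_simps(1))
    thus "valuation_on UNIV w'"
      by (auto simp: valuation_on_def w'_def rf_const_simps(2,5) w.val_mult)
  qed auto
  show 1: "0 \<le> w (rf_const \<pi>)" using valuation_uniformizer_nonneg[OF w' p] by (simp add: w'_def)
  show 3: "w (rf_const c) = v c * w (rf_const \<pi>)" if "c \<noteq> 0" for c
    using valuation_eq_multiple[OF w' p that] by (simp add: w'_def)
  from w obtain i where i: "i \<le> m" "(\<lambda>c. w (rf_const c)) ` (UNIV - {0}) = range (\<lambda>k. int i * k)"
    by (auto simp: Omega_def)
  have "w (rf_const \<pi>) \<in> range (\<lambda>k. int i * k)" using i(2) p by blast
  hence d1: "int i dvd w (rf_const \<pi>)" by auto
  have "int i * 1 \<in> range (\<lambda>k. int i * k)" by (rule rangeI)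
  hence "int i * 1 \<in> (\<lambda>c. w (rf_const c)) ` (UNIV - {0})" using i(2) by simp
  then obtain c where "c \<noteq> 0" "int i = w (rf_const c)" by auto
  hence "w (rf_const \<pi>) dvd int i" using 3 by simp
  hence "w (rf_const \<pi>) = int i" using d1 1 by (intro zdvd_antisym_nonneg) auto
  thus "w (rf_const \<pi>) \<le> int m" using i(1) by simp
qed

lemma ac_poly_phi_poly:
  "ac_poly (monom 1 r - [:p:]) x = x ^ r - to_ac p" "ac_poly (monom 1 (r + 1) + [:p:]) x = x ^ (r + 1) + to_ac p"
  "ac_poly [:0, p:] x = to_ac p * x" "ac_poly (monom 1 (r + 1) + [:0, p:]) x = x * (x ^ r + to_ac p)"
proof -
  have m: "ac_poly (monom 1 n) x = x ^ n" for n by (simp add: ac_poly_def map_poly_monom poly_monom)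
  show l: "ac_poly [:0, p:] x = to_ac p * x" by (simp add: ac_poly_def map_poly_pCons mult.commute)
  show "ac_poly (monom 1 r - [:p:]) x = x ^ r - to_ac p" "ac_poly (monom 1 (r + 1) + [:p:]) x = x ^ (r + 1) + to_ac p"
    "ac_poly (monom 1 (r + 1) + [:0, p:]) x = x * (x ^ r + to_ac p)"
    unfolding ac_poly_diff ac_poly_add m l by (simp_all add: algebra_simps)
qed

theorem isotropic_trivial:
  assumes w: "Z_valuation w" and triv: "\<And>c. c \<noteq> 0 \<Longrightarrow> w (rf_const c) = 0" and X: "w rf_X = 0"
    and p: "\<pi> \<noteq> 0" "v \<pi> = 1"
  shows "isotropic (completion w) (map (to_completion w) (phi \<pi> r))"
proof -
  interpret w: completed_field w
    using Z_valuation_valued_field[OF w] by (simp add: completed_field_def)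
  obtain x where nonneg: "\<And>f. f \<noteq> 0 \<Longrightarrow> w (to_fract f) \<ge> 0"
    and zero: "\<And>f. f \<noteq> 0 \<Longrightarrow> w (to_fract f) > 0 \<longleftrightarrow> ac_poly f x = 0"
    using residue_point[OF w triv] X by auto
  define K where "K = adjoin (range to_ac) x"
  have K: "finite_extension K" unfolding K_def by (rule finite_extension_simple)
  have xK: "x \<in> K" unfolding K_def by (rule mem_adjoin_range_to_ac)
  from henselian K obtain u where "extends_to v K u" unfolding henselian_def by blast
  then interpret ext: extended_valuation v K u using extended_valuation_iff[OF K] by simp
  obtain c where c: "- 1 = (c::'a)\<^sup>2" using unit_is_square[of "- 1"] val_uminus_one by auto
  have two': "(2 :: 'a poly fract) = rf_const 2"
    using rf_const_simps(1)[of 1 1] by (simp add: rf_const_simps)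
  have two2: "(2 :: 'a poly fract) \<noteq> 0" "w 2 = 0"
    using two(1) triv[of 2] by (auto simp: two' rf_const_simps)
  define F where "F = phi_poly \<pi> r"
  have len: "length F = 4" by (simp add: F_def phi_poly_def)
  have pair: ?thesis if ij: "i < 4" "j < 4" "i \<noteq> j" "ac_poly (F ! i) x \<noteq> 0" "ac_poly (F ! j) x \<noteq> 0"
    and y: "y \<in> K" "ac_poly (F ! j) x = ac_poly (F ! i) x * y\<^sup>2" for i j y
  proof -
    obtain h where h: "y = ac_poly h x" using adjoin_range_to_ac y(1) unfolding K_def by blast
    define g where "g = F ! j + F ! i * ([:c:] * h)\<^sup>2"
    have "ac_poly g x = ac_poly (F ! j) x + ac_poly (F ! i) x * (to_ac (c\<^sup>2) * y\<^sup>2)"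
      by (simp only: g_def ac_poly_add ac_poly_mult ac_poly_power ac_poly_const h to_ac_power power_mult_distrib)
    also have "\<dots> = 0" by (simp add: y(2) flip: c)
    finally have g: "w.val_gt 0 (to_fract g)"
      using zero[of g] by (auto simp: w.val_gt_def)
    have nz: "F ! i \<noteq> 0" "F ! j \<noteq> 0" using ij by auto
    have "w (to_fract (F ! j)) = 0"
      using zero[OF nz(2)] nonneg[OF nz(2)] ij(5) by auto
    hence "w.val_gt (w (map to_fract F ! j)) (map to_fract F ! j + map to_fract F ! i * (to_fract ([:c:] * h))\<^sup>2)"
      using g ij len by (simp add: g_def to_fract_add to_fract_mult to_fract_power)
    thus ?thesis unfolding phi_eq_map F_def[symmetric]
      using ij len nz by (intro w.isotropic_completionI[OF two2, of i _ j]) auto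
  qed
  have triple: ?thesis if ijk: "i < 4" "j < 4" "k < 4" "i \<noteq> j" "j \<noteq> k" "i \<noteq> k"
    "ac_poly (F ! i) x \<noteq> 0" "ac_poly (F ! j) x \<noteq> 0" "ac_poly (F ! k) x \<noteq> 0" for i j k
    using three_elements_square_ratio[OF K ext.ac_poly_closed ext.ac_poly_closed ext.ac_poly_closed, OF xK xK xK ijk(7-9)]
      pair ijk by metis
  have F: "ac_poly (F ! 0) x = x ^ r - to_ac \<pi>" "ac_poly (F ! 1) x = x ^ (r + 1) + to_ac \<pi>"
    "ac_poly (F ! 2) x = to_ac \<pi> * x" "ac_poly (F ! 3) x = x * (x ^ r + to_ac \<pi>)"
  proof -
    have "F ! 0 = monom 1 r - [:\<pi>:]" "F ! 1 = monom 1 (r + 1) + [:\<pi>:]" "F ! 2 = [:0, \<pi>:]"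
      "F ! 3 = monom 1 (r + 1) + [:0, \<pi>:]" by (simp_all add: F_def phi_poly_def)
    thus "ac_poly (F ! 0) x = x ^ r - to_ac \<pi>" "ac_poly (F ! 1) x = x ^ (r + 1) + to_ac \<pi>"
      "ac_poly (F ! 2) x = to_ac \<pi> * x" "ac_poly (F ! 3) x = x * (x ^ r + to_ac \<pi>)"
      by (simp_all only: ac_poly_phi_poly)
  qed
  have x0: "x \<noteq> 0" using zero[of "[:0, 1:]"] X by (auto simp: rf_X_def ac_poly_def map_poly_pCons)
  have p0: "to_ac \<pi> \<noteq> 0" using p by simp
  have ne: "to_ac \<pi> \<noteq> (- 1) ^ r" "to_ac \<pi> \<noteq> - 1"
  proof -
    have *: "v ((- 1) ^ n) = 0" for n using val_power_unit[of "- 1" n] val_uminus_one by simp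
    have "\<pi> \<noteq> (- 1) ^ n" for n using *[of n] p by auto
    hence "to_ac \<pi> \<noteq> to_ac ((- 1) ^ n)" for n unfolding to_ac_eq_iff .
    from this[of r] this[of 1] show "to_ac \<pi> \<noteq> (- 1) ^ r" "to_ac \<pi> \<noteq> - 1" by simp_all
  qed
  have n01: "\<not> (ac_poly (F ! 0) x = 0 \<and> ac_poly (F ! 1) x = 0)"
  proof
    assume "ac_poly (F ! 0) x = 0 \<and> ac_poly (F ! 1) x = 0"
    hence e: "x ^ r = to_ac \<pi>" "x * x ^ r + to_ac \<pi> = 0" unfolding F by auto
    have "to_ac \<pi> * (x + 1) = 0" using e by (simp add: algebra_simps)
    hence "x = - 1" using p0 by (simp add: eq_neg_iff_add_eq_0)
    thus False using e(1) ne(1) by simp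
  qed
  have n03: "\<not> (ac_poly (F ! 0) x = 0 \<and> ac_poly (F ! 3) x = 0)"
  proof
    assume "ac_poly (F ! 0) x = 0 \<and> ac_poly (F ! 3) x = 0"
    hence "x ^ r = to_ac \<pi>" "x ^ r + to_ac \<pi> = 0" using x0 unfolding F by auto
    hence "to_ac (\<pi> + \<pi>) = 0" by simp
    hence "2 * \<pi> = 0" by (simp only: to_ac_eq_0_iff mult_2)
    thus False using p two by simp
  qed
  have n13: "\<not> (ac_poly (F ! 1) x = 0 \<and> ac_poly (F ! 3) x = 0)"
  proof
    assume "ac_poly (F ! 1) x = 0 \<and> ac_poly (F ! 3) x = 0"
    hence e: "x * x ^ r + to_ac \<pi> = 0" "x ^ r + to_ac \<pi> = 0" using x0 unfolding F by auto
    hence "x ^ r = - to_ac \<pi>" by (simp add: eq_neg_iff_add_eq_0)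
    hence "to_ac \<pi> * (1 - x) = 0" using e(1) by (simp add: algebra_simps)
    hence "x = 1" using p0 by simp
    hence "to_ac \<pi> = - 1" using e(2) by (simp add: eq_neg_iff_add_eq_0 add.commute)
    thus False using ne(2) by simp
  qed
  have n2: "ac_poly (F ! 2) x \<noteq> 0" using p0 x0 by (simp add: F)
  consider "ac_poly (F ! 1) x \<noteq> 0" "ac_poly (F ! 3) x \<noteq> 0" | "ac_poly (F ! 0) x \<noteq> 0" "ac_poly (F ! 3) x \<noteq> 0"
    | "ac_poly (F ! 0) x \<noteq> 0" "ac_poly (F ! 1) x \<noteq> 0"
    using n01 n03 n13 by blast
  thus ?thesis
  proof cases
    case 1 thus ?thesis using n2 by (intro triple[of 1 2 3]) auto
  next
    case 2 thus ?thesis using n2 by (intro triple[of 0 2 3]) auto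
  next
    case 3 thus ?thesis using n2 by (intro triple[of 0 1 2]) auto
  qed
qed

theorem isotropic_Omega:
  assumes w: "w \<in> Omega (r - 1)" and p: "\<pi> \<noteq> 0" "v \<pi> = 1" and r: "r > 0"
  shows "isotropic (completion w) (map (to_completion w) (phi \<pi> r))"
proof -
  from w have Zw: "Z_valuation w" by (simp add: Omega_def)
  have wv: "valued_field UNIV w" using Zw by (rule Z_valuation_valued_field)
  interpret w: completed_field w using wv by (simp add: completed_field_def)
  define P where "P = rf_const \<pi>"
  define T where "T = (rf_X :: 'a poly fract)"
  define e where "e = w T"
  have nz: "P \<noteq> 0" "T \<noteq> 0" using p by (auto simp: P_def T_def rf_const_simps rf_X_nonzero)
  note res = Omega_restriction[OF w p]
  have P: "0 \<le> w P" "w P < int r" using res(1,2) r by (auto simp: P_def)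
  have Tn: "w (T ^ n) = int n * e" for n using valuation_power[OF wv nz(2)] by (simp add: e_def)
  have two': "(2 :: 'a poly fract) = rf_const 2"
    using rf_const_simps(1)[of 1 1] by (simp add: rf_const_simps)
  have two2: "(2 :: 'a poly fract) \<noteq> 0" "w 2 = 0"
    using two res(3)[of 2] by (auto simp: two' rf_const_simps)
  define as where "as = phi \<pi> r"
  have as: "length as = 4" "as ! 0 = T ^ r - P" "as ! 1 = T ^ (r + 1) + P" "as ! 3 = T * (T ^ r + P)"
    "as ! Suc 0 = T ^ (r + 1) + P"
    by (simp_all add: as_def phi_def P_def T_def)
  consider "e \<ge> 1" | "e \<le> 0" "w P \<noteq> 0 \<or> e \<noteq> 0" | "e = 0" "w P = 0" by linarith
  thus ?thesis
  proof cases
    case 1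
    have ge: "int n * e \<ge> int r" if "n \<ge> r" for n
      using mult_mono[of "int r" "int n" 1 e] 1 that by simp
    have gt: "w.val_gt (w P) (T ^ n)" if "n \<ge> r" for n
      using ge[OF that] P(2) by (simp add: w.val_gt_def Tn)
    have a0: "as ! 0 \<noteq> 0" "w (as ! 0) = w P"
      using w.val_add_gt[of "- P" "T ^ r"] gt[of r] nz by (simp_all add: as w.val_uminus)
    have a1: "as ! 1 \<noteq> 0"
      using w.val_add_gt[of P "T ^ (r + 1)"] gt[of "r + 1"] nz unfolding as by (simp add: add.commute)
    have "as ! 0 + as ! 1 * 1\<^sup>2 = T ^ r + T ^ (r + 1)" by (simp add: as)
    moreover have "w.val_gt (w P) (T ^ r + T ^ (r + 1))"
      using gt[of r] gt[of "r + 1"] by (intro w.val_gt_add) auto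
    ultimately show ?thesis unfolding as_def[symmetric]
      using a0 a1 as(1) by (intro w.isotropic_completionI[OF two2, of 1 _ 0 1]) auto
  next
    case 2
    have re: "int r * e \<le> 0" "int (r + 1) * e = int r * e + e"
      using 2(1) by (simp add: mult_nonneg_nonpos) (simp add: algebra_simps)
    have re': "int r * e < 0" if "e < 0" using r that by (simp add: mult_pos_neg)
    have lt: "int (r + 1) * e < w P" "int (r + 1) * e < e + w P"
      using re re' P(1) 2 by (cases "e < 0"; linarith)+
    obtain c where c: "- 1 = (c::'a)\<^sup>2" using unit_is_square[of "- 1"] val_uminus_one by auto
    have c': "(rf_const c)\<^sup>2 = - 1"
    proof -
      have "(rf_const c)\<^sup>2 = rf_const (c\<^sup>2)" by (simp add: power2_eq_square rf_const_simps(2))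
      thus ?thesis by (simp add: rf_const_simps(3,4) flip: c)
    qed
    have gtP: "w.val_gt (int (r + 1) * e) P" "w.val_gt (int (r + 1) * e) (T * P)"
      using lt nz by (auto simp: w.val_gt_def w.val_mult e_def)
    have a1: "as ! 1 \<noteq> 0" "w (as ! 1) = int (r + 1) * e"
      using w.val_add_gt[of "T ^ (r + 1)" P] gtP nz Tn[of "r + 1"] by (simp_all add: as)
    have eq3: "as ! 3 = T ^ (r + 1) + T * P" by (simp add: as algebra_simps)
    have a3: "as ! 3 \<noteq> 0"
      using w.val_add_gt[of "T ^ (r + 1)" "T * P"] gtP nz Tn[of "r + 1"] by (simp add: eq3)
    have "as ! 1 + as ! 3 * (rf_const c)\<^sup>2 = P - T * P" by (simp add: c' as algebra_simps)
    moreover have "w.val_gt (int (r + 1) * e) (P - T * P)"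
      using gtP by (intro w.val_gt_diff) auto
    ultimately show ?thesis unfolding as_def[symmetric]
      using a1 a3 as(1) by (intro w.isotropic_completionI[OF two2, of 3 _ 1 "rf_const c"]) auto
  next
    case 3
    show ?thesis
      using isotropic_trivial[OF Zw _ _ p] res(3) 3 by (simp add: P_def T_def e_def)
  qed
qed

end

lemma anisotropic_gauss:
  fixes v :: "'a::field \<Rightarrow> int"
  assumes v: "Z_valuation v" and p: "\<pi> \<noteq> 0" "v \<pi> = 1" and r: "r > 0"
  shows "\<exists>w\<in>Omega r. anisotropic (completion w) (map (to_completion w) (phi \<pi> r))"
proof -
  interpret v: valued_field UNIV v using v by (rule Z_valuation_valued_field)
  define u where "u c = int r * v c" for c
  have "valuation_on UNIV u"
    unfolding valuation_on_def u_def
  proof (intro conjI ballI impI)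
    fix x y :: 'a assume xy: "x \<in> UNIV - {0}" "y \<in> UNIV - {0}"
    show "int r * v (x * y) = int r * v x + int r * v y" using xy by (simp add: v.val_mult algebra_simps)
    assume "x + y \<noteq> 0"
    hence "min (v x) (v y) \<le> v (x + y)" using xy by (intro v.val_add) auto
    thus "min (int r * v x) (int r * v y) \<le> int r * v (x + y)"
      by (auto simp: min_le_iff_disj intro!: mult_left_mono)
  qed
  then interpret gauss u by unfold_locales auto
  have vp: "u 1 = 0" "u \<pi> = int r" "u (- \<pi>) = int r"
    using p by (simp_all add: u_def v.val_one v.val_uminus)
  have lead: "gauss_lead (monom 1 r - [:\<pi>:]) (int r) r" "gauss_lead (monom 1 (r + 1) + [:\<pi>:]) (int r) 0"
    "gauss_lead [:0, \<pi>:] (int r + 1) 1" "gauss_lead (monom 1 (r + 1) + [:0, \<pi>:]) (int r + 1) (r + 1)"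
    using r p vp by (auto simp: gauss_lead_def val_ge_def val_gt_def coeff_pCons split: nat.splits)
  have wX: "gauss_val rf_X = 1"
    using gauss_val_to_fract[OF gauss_lead_monom[of 1 1]] vp by (simp add: rf_X_def monom_altdef)
  have "Z_valuation gauss_val"
    unfolding Z_valuation_def
  proof
    have "n \<in> gauss_val ` (UNIV - {0})" for n
    proof (cases "n \<ge> 0")
      case True
      thus ?thesis using valuation_power[OF W.valued_field_axioms, of rf_X "nat n"] wX
        by (intro image_eqI[of _ _ "rf_X ^ nat n"]) (auto simp: rf_X_nonzero)
    next
      case False
      thus ?thesis using valuation_power[OF W.valued_field_axioms, of rf_X "nat (- n)"] wX
        by (intro image_eqI[of _ _ "inverse (rf_X ^ nat (- n))"]) (auto simp: rf_X_nonzero W.val_inverse)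
    qed
    thus "gauss_val ` (UNIV - {0}) = UNIV" by blast
  qed (rule gauss_val_valuation)
  moreover have "(\<lambda>c. gauss_val (rf_const c)) ` (UNIV - {0}) = range (\<lambda>k. int r * k)"
  proof -
    have "gauss_val (rf_const c) = int r * v c" if "c \<noteq> 0" for c
      using gauss_val_to_fract[OF gauss_lead_monom[OF that, of 0]] by (simp add: rf_const_def monom_0 u_def)
    hence "(\<lambda>c. gauss_val (rf_const c)) ` (UNIV - {0}) = (\<lambda>c. int r * v c) ` (UNIV - {0})"
      by (intro image_cong) auto
    also have "\<dots> = (\<lambda>k. int r * k) ` (v ` (UNIV - {0}))" by (simp add: image_image)
    also have "v ` (UNIV - {0}) = UNIV" using v by (simp add: Z_valuation_def)
    finally show ?thesis .
  qed
  ultimately have "gauss_val \<in> Omega r" by (auto simp: Omega_def)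
  moreover have "anisotropic (completion gauss_val) (map (to_completion gauss_val) (map to_fract (phi_poly \<pi> r)))"
  proof (rule anisotropic_completion)
    define \<alpha> where "\<alpha> i = (if i < 2 then int r else int r + 1)" for i :: nat
    define \<delta> where "\<delta> i = [r, 0, 1, r + 1] ! i" for i
    show "gauss_lead (phi_poly \<pi> r ! i) (\<alpha> i) (\<delta> i)" if "i < length (phi_poly \<pi> r)" for i
    proof -
      have "i = 0 \<or> i = 1 \<or> i = 2 \<or> i = 3" using that by (auto simp: phi_poly_def)
      thus ?thesis using lead by (auto simp: phi_poly_def \<alpha>_def \<delta>_def)
    qed
    show "(\<alpha> i + 2 * \<mu>, \<delta> i + 2 * d) \<noteq> (\<alpha> j + 2 * \<nu>, \<delta> j + 2 * e)"
      if ij: "i < length (phi_poly \<pi> r)" "j < length (phi_poly \<pi> r)" "i \<noteq> j"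
        and fg: "gauss_lead f \<mu> d" "gauss_lead g \<nu> e" for i j f g \<mu> d \<nu> e
    proof
      assume eq: "(\<alpha> i + 2 * \<mu>, \<delta> i + 2 * d) = (\<alpha> j + 2 * \<nu>, \<delta> j + 2 * e)"
      obtain k l where kl: "\<mu> = int d + int r * k" "\<nu> = int e + int r * l"
      proof -
        have "\<mu> = int d + int r * v (coeff f d)" "\<nu> = int e + int r * v (coeff g e)"
          using fg by (simp_all add: gauss_lead_def u_def)
        thus thesis by (rule that)
      qed
      have odd: "False" if "int r = 2 * (int r * m)" for m
      proof -
        have "int r * 1 = int r * (2 * m)" using that by (simp only: mult.left_commute mult_1_right)
        hence "1 = 2 * m" using r by (simp only: mult_cancel_left) auto
        thus False by presburger
      qed
      have "i = 0 \<or> i = 1 \<or> i = 2 \<or> i = 3" "j = 0 \<or> j = 1 \<or> j = 2 \<or> j = 3"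
        using ij by (auto simp: phi_poly_def)
      moreover have "\<alpha> i = \<alpha> j"
      proof (rule ccontr)
        assume "\<alpha> i \<noteq> \<alpha> j"
        hence "\<alpha> i = \<alpha> j + 1 \<or> \<alpha> j = \<alpha> i + 1" by (auto simp: \<alpha>_def split: if_splits)
        thus False using eq by simp presburger
      qed
      ultimately have "{i, j} = {0, 1} \<or> {i, j} = {2, 3}"
        using ij(3) by (auto simp: \<alpha>_def split: if_splits)
      hence "\<delta> i = \<delta> j + r \<or> \<delta> j = \<delta> i + r"
        by (auto simp: \<delta>_def doubleton_eq_iff)
      moreover have "\<mu> = \<nu>" using eq \<open>\<alpha> i = \<alpha> j\<close> by simp
      hence de: "int d - int e = int r * (l - k)" using kl by (simp add: algebra_simps)
      moreover have "int (\<delta> i) + 2 * int d = int (\<delta> j) + 2 * int e" using eq by simp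
      ultimately have "int r = 2 * (int r * (l - k)) \<or> int r = 2 * (- (int r * (l - k)))"
        by linarith
      thus False using odd[of "l - k"] odd[of "- (l - k)"] by (simp only: mult_minus_right) blast
    qed
  qed
  ultimately show ?thesis by (metis phi_eq_map)
qed

theorem mainTheorem1:
  fixes v :: "'a::field \<Rightarrow> int" and \<pi> :: 'a and r :: nat
  assumes "CHAR('a) \<noteq> 2"
    and "Z_valuation v"
    and "henselian v"
    and "v 2 = 0"
    and "separably_closed (residue_field v)"
    and "\<pi> \<noteq> 0" and "v \<pi> = 1"
    and "r > 0"
  shows "(\<forall>w\<in>Omega (r - 1). isotropic (completion w) (map (to_completion w) (phi \<pi> r))) \<and>
         (\<exists>w\<in>Omega r. anisotropic (completion w) (map (to_completion w) (phi \<pi> r)))"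
proof
  have "(2::'a) \<noteq> 0"
  proof
    assume "(2::'a) = 0"
    hence "of_nat 2 = (0::'a)" by simp
    hence "CHAR('a) dvd 2" by (simp only: of_nat_eq_0_iff_char_dvd)
    hence "CHAR('a) = 1" using assms(1) by (metis prime_nat_iff two_is_prime_nat)
    thus False using CHAR_not_1'[where 'a = 'a] by simp
  qed
  hence "henselian_field v"
    using assms Z_valuation_valued_field[OF assms(2)]
    by (simp add: henselian_field_def henselian_field_axioms_def residue_map_def)
  then interpret henselian_field v .
  show "\<forall>w\<in>Omega (r - 1). isotropic (completion w) (map (to_completion w) (phi \<pi> r))"
    using isotropic_Omega assms by blast
  show "\<exists>w\<in>Omega r. anisotropic (completion w) (map (to_completion w) (phi \<pi> r))"
    using anisotropic_gauss assms by blast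
qed

end
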